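(* Let $a$ and $k$ be integers with $k \ge 1$ and $\gcd(a,k)=1$. Then the arithmetic progression $a,\ a+k,\ a+2k,\ a+3k,\dots$ contains infinitely many prime numbers; that is, there are infinitely many primes $q$ of the form $q = a + \mu k$ with $\mu$ a non-negative integer. *)

theory Defs
  imports "HOL-Computational_Algebra.Primes"
begin

end

theory Submission
  imports
    Defs
    "HOL-Computational_Algebra.Squarefree"
    "HOL-Number_Theory.Number_Theory"
    "HOL-Analysis.Convex"
    "HOL-Analysis.Summation_Tests"
begin

text \<open>
  Write \<open>\<Lambda>\<close> for the von Mangoldt function. For a character \<open>\<chi>\<close> modulo \<open>k\<close>, the sum of
  \<open>\<chi>(n) \<Lambda>(n) / n\<close> over \<open>n \<le> N\<close> is \<open>ln N + O(1)\<close> if \<open>\<chi>\<close> is principal, \<open>O(1)\<close> if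
  \<open>L(1, \<chi>) \<noteq> 0\<close>, and \<open>- ln N + O(1)\<close> if \<open>L(1, \<chi>) = 0\<close>. Summing over all characters
  yields the sum of \<open>\<Lambda>(n) / n\<close> over \<open>n \<equiv> 1\<close>, which is nonnegative; so \<open>L(1, \<chi>)\<close> vanishes
  for at most one \<open>\<chi>\<close>, which then equals its own conjugate. Monsky's argument excludes this
  last case: for real \<open>\<chi>\<close> the coefficients of the Lambert series of \<open>\<chi>\<close> are nonnegative, and
  at least 1 at squares, so the series is unbounded as \<open>t\<close> tends to 1, whereas \<open>L(1, \<chi>) = 0\<close>
  and partial summation bound it. By orthogonality the sum of \<open>\<Lambda>(n) / n\<close> over \<open>n \<equiv> a\<close> is
  then unbounded, and proper prime powers contribute only \<open>O(1)\<close> to it.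
\<close>

unbundle no vec_syntax

section \<open>Existence of characters separating residue classes\<close>

text \<open>All \<open>O(1)\<close> estimates are made at finite \<open>N\<close> by one scheme. A
  sum over \<open>n \<le> N\<close> of a divisor sum is regrouped as a sum over \<open>d\<close> of
  a coefficient times a partial sum up to \<open>N div d\<close>. For nonprincipal
  \<open>\<chi>\<close> these are partial sums of \<open>L(1, \<chi>)\<close>, whose tail is
  \<open>O(d / N)\<close>; with a coefficient of size \<open>w(d) / d\<close> the total error is
  \<open>O(1 / N)\<close> times the sum of \<open>w(d)\<close>. Here \<open>w\<close> is
  \<open>\<Lambda>\<close>, hence Chebyshev's bound, or \<open>ln (N / d)\<close>, whose sum is at
  most \<open>N\<close>. For principal \<open>\<chi>\<close> the series diverges, and the partial
  sums of \<open>\<chi>\<close> itself, linear up to a bounded error, take its place. Nonnegativity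
  over \<open>n \<equiv> 1\<close> stops at one vanishing character: with \<open>V\<close> of them
  the coefficient of \<open>ln N\<close> is \<open>1 - V\<close>, and for \<open>V = 1\<close> it is
  0, which nonnegativity permits. Therefore the real case calls for an argument of its own.
  Orthogonality rests on having enough characters. They are built one generator at a time, which
  works because complex numbers have roots of every order.\<close>

text \<open>A character on a subgroup of the unit group modulo \<open>k\<close>; the subgroup is encoded as a union
  \<open>H\<close> of residue classes of natural numbers. Closure under inverses is automatic, since inverses
  are powers by Euler's theorem.\<close>

definition partial_char :: "nat \<Rightarrow> nat set \<Rightarrow> (nat \<Rightarrow> complex) \<Rightarrow> bool" where
  "partial_char k H \<chi> \<longleftrightarrow>
     H \<subseteq> {n. coprime n k} \<and> 1 \<in> H \<and> \<chi> 1 = 1 \<and>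
     (\<forall>m\<in>H. \<forall>n\<in>H. m * n \<in> H \<and> \<chi> (m * n) = \<chi> m * \<chi> n) \<and>
     (\<forall>m\<in>H. \<forall>n. [m = n] (mod k) \<longrightarrow> n \<in> H \<and> \<chi> n = \<chi> m)"

lemma partial_charD:
  assumes "partial_char k H \<chi>"
  shows "n \<in> H \<Longrightarrow> coprime n k" "Suc 0 \<in> H" "\<chi> (Suc 0) = 1"
    "\<And>m n. m \<in> H \<Longrightarrow> n \<in> H \<Longrightarrow> m * n \<in> H"
    "\<And>m n. m \<in> H \<Longrightarrow> n \<in> H \<Longrightarrow> \<chi> (m * n) = \<chi> m * \<chi> n"
    "\<And>m n. m \<in> H \<Longrightarrow> [m = n] (mod k) \<Longrightarrow> n \<in> H"
    "\<And>m n. m \<in> H \<Longrightarrow> [m = n] (mod k) \<Longrightarrow> \<chi> n = \<chi> m"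
  using assms unfolding partial_char_def One_nat_def by blast+

lemma partial_char_power:
  assumes "partial_char k H \<chi>" "m \<in> H"
  shows "m ^ j \<in> H" "\<chi> (m ^ j) = \<chi> m ^ j"
proof -
  have "m ^ j \<in> H \<and> \<chi> (m ^ j) = \<chi> m ^ j"
  proof (induction j)
    case 0
    show ?case using partial_charD(2,3)[OF assms(1)] by simp
  next
    case (Suc j)
    thus ?case using partial_charD(4,5)[OF assms(1) assms(2), of "m ^ j"] by simp
  qed
  thus "m ^ j \<in> H" "\<chi> (m ^ j) = \<chi> m ^ j" by auto
qed

text \<open>The exponents that lead into \<open>H\<close> are closed under reduction modulo the
  least positive one, because a power of \<open>x ^ m\<close> cancels
  \<open>x ^ (m * q)\<close>.\<close>

lemma partial_char_power_in_dvd: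
  assumes P: "partial_char k H \<chi>" and x: "coprime x k"
  and m: "0 < m" "x ^ m \<in> H" "\<And>i. 0 < i \<Longrightarrow> i < m \<Longrightarrow> x ^ i \<notin> H"
  and i: "x ^ i \<in> H"
  shows "m dvd i"
proof -
  define q r t where "q = i div m" and "r = i mod m" and "t = totient k"
  have iq: "i = r + m * q" unfolding q_def r_def by simp
  have "[x ^ t = 1] (mod k)"
    unfolding t_def using x by (rule euler_theorem)
  from cong_pow[OF this, of "m * q"] have 1: "[x ^ (t * (m * q)) = 1] (mod k)"
    by (simp add: power_mult)
  have tpos: "t > 0 \<or> k = 0" by (auto simp: t_def)
  have "x ^ r \<in> H"
  proof (cases "k = 0")
    case True
    hence "x = 1" using x by simp
    thus ?thesis using partial_charD(2)[OF P] by simp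
  next
    case False
    hence "t > 0" using tpos by simp
    \<comment> \<open>Modulo \<open>k\<close>, the factor \<open>(x ^ m) ^ (q * (t - 1))\<close> is
      the inverse of \<open>(x ^ m) ^ q\<close>, so multiplying \<open>x ^ i\<close> by it leaves
      \<open>x ^ r\<close>.\<close>
    hence e: "i + m * (q * (t - 1)) = r + t * (m * q)"
      unfolding iq by (cases t) (auto simp: algebra_simps)
    have "x ^ i * (x ^ m) ^ (q * (t - 1)) \<in> H"
      by (intro partial_charD(4)[OF P] i partial_char_power(1)[OF P] m)
    hence "x ^ r * x ^ (t * (m * q)) \<in> H"
      by (simp only: power_mult[symmetric] power_add[symmetric] e)
    moreover have "[x ^ r * x ^ (t * (m * q)) = x ^ r * 1] (mod k)"
      by (intro cong_mult 1) auto
    ultimately show ?thesis using partial_charD(6)[OF P] by simp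
  qed
  moreover have "r < m" using m(1) by (simp add: r_def)
  ultimately have "r = 0" using m(3)[of r] by blast
  thus ?thesis by (simp add: iq)
qed

text \<open>On the subgroup generated by \<open>H\<close> and \<open>x\<close>, send
  \<open>h * x ^ j\<close> to \<open>\<chi> h * z ^ j\<close>. Two representations of one class
  differ by a power \<open>x ^ i\<close> in \<open>H\<close>; then \<open>m\<close> divides
  \<open>i\<close>, and the choice of \<open>z\<close> as an \<open>m\<close>-th root of
  \<open>\<chi> (x ^ m)\<close> makes both values agree.\<close>

lemma partial_char_extend:
  assumes P: "partial_char k H \<chi>" and x: "coprime x k"
  and m: "0 < m" "x ^ m \<in> H" "\<And>i. 0 < i \<Longrightarrow> i < m \<Longrightarrow> x ^ i \<notin> H"
  and z: "z ^ m = \<chi> (x ^ m)"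
  obtains H' \<chi>' where "partial_char k H' \<chi>'" "H \<subseteq> H'" "x \<in> H'" "\<chi>' x = z"
    "\<And>h. h \<in> H \<Longrightarrow> \<chi>' h = \<chi> h"
proof -
  note D = partial_charD[OF P]
  have zi: "\<chi> (x ^ i) = z ^ i" if i: "x ^ i \<in> H" for i
  proof -
    obtain q where "i = m * q"
      using partial_char_power_in_dvd[OF P x m i] by (auto elim: dvdE)
    thus ?thesis using partial_char_power(2)[OF P m(2), of q] z
      by (simp add: power_mult)
  qed
  have wd: "\<chi> h * z ^ j = \<chi> h' * z ^ j'"
    if "h \<in> H" "h' \<in> H" "[h * x ^ j = h' * x ^ j'] (mod k)" "j \<le> j'" for h h' j j'
  proof -
    obtain i where j': "j' = i + j" using \<open>j \<le> j'\<close> le_iff_add by (metis add.commute)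
    have "[h * x ^ j = (h' * x ^ i) * x ^ j] (mod k)"
      using that(3) by (simp add: j' power_add mult_ac)
    hence c: "[h = h' * x ^ i] (mod k)"
      using x by (simp add: cong_mult_rcancel_nat)
    \<comment> \<open>An inverse of \<open>h'\<close> inside \<open>H\<close>: multiplying by it
      turns the relation \<open>c\<close> into \<open>x ^ i \<in> H\<close>, where \<open>zi\<close>
      applies.\<close>
    define g where "g = h' ^ (totient k - 1)"
    have g: "g \<in> H" unfolding g_def by (rule partial_char_power(1)[OF P that(2)])
    have hg: "[h' * g = 1] (mod k)"
    proof (cases "k = 0")
      case True
      hence "h' = 1" using D(1)[OF that(2)] by simp
      thus ?thesis by (simp add: g_def)
    next
      case False
      hence "totient k > 0" by simp
      hence "h' * g = h' ^ totient k"
        unfolding g_def by (cases "totient k") auto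
      thus ?thesis using euler_theorem[OF D(1)[OF that(2)]] by simp
    qed
    have "[g * h = (h' * g) * x ^ i] (mod k)"
      using cong_mult[OF cong_refl[of g] c] by (simp add: mult_ac)
    also have "[(h' * g) * x ^ i = 1 * x ^ i] (mod k)"
      by (intro cong_mult hg) auto
    finally have "[g * h = x ^ i] (mod k)" by simp
    hence xi: "x ^ i \<in> H" using D(6)[OF D(4)[OF g that(1)]] by simp
    have "\<chi> h = \<chi> (h' * x ^ i)"
      using D(7)[OF that(1) c] by simp
    also have "\<dots> = \<chi> h' * z ^ i" using D(5)[OF that(2) xi] zi[OF xi] by simp
    finally show ?thesis by (simp add: j' power_add)
  qed
  define H' where "H' = {n. \<exists>h\<in>H. \<exists>j. [n = h * x ^ j] (mod k)}"
  define \<chi>' where "\<chi>' = (\<lambda>n. THE v. \<exists>h\<in>H. \<exists>j. [n = h * x ^ j] (mod k) \<and> v = \<chi> h * z ^ j)"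
  have val: "\<chi>' n = \<chi> h * z ^ j" if "h \<in> H" "[n = h * x ^ j] (mod k)" for n h j
    unfolding \<chi>'_def
  proof (rule the_equality)
    fix v assume "\<exists>h\<in>H. \<exists>j. [n = h * x ^ j] (mod k) \<and> v = \<chi> h * z ^ j"
    then obtain h' j' where h': "h' \<in> H" "[n = h' * x ^ j'] (mod k)" "v = \<chi> h' * z ^ j'"
      by blast
    have c: "[h * x ^ j = h' * x ^ j'] (mod k)" "[h' * x ^ j' = h * x ^ j] (mod k)"
      using h'(2) that(2) by (auto intro: cong_trans cong_sym)
    show "v = \<chi> h * z ^ j"
      using wd[OF that(1) h'(1) c(1)] wd[OF h'(1) that(1) c(2)] h'(3)
      by (cases "j \<le> j'") auto
  qed (use that in blast)
  have sub: "H \<subseteq> H'"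
    unfolding H'_def by (force intro: exI[of _ 0])
  have "partial_char k H' \<chi>'"
    unfolding partial_char_def
  proof (intro conjI ballI allI impI)
    show "H' \<subseteq> {n. coprime n k}"
    proof
      fix n assume "n \<in> H'"
      then obtain h j where h: "h \<in> H" "[n = h * x ^ j] (mod k)" unfolding H'_def by blast
      have "coprime (h * x ^ j) k" using D(1)[OF h(1)] x by simp
      thus "n \<in> {n. coprime n k}" using h(2) cong_imp_coprime cong_sym by blast
    qed
    show "1 \<in> H'" using sub D(2) by auto
    show "\<chi>' 1 = 1" using val[of 1 1 0] D(2,3) by simp
  next
    fix a b assume "a \<in> H'" "b \<in> H'"
    then obtain h j h' j' where h: "h \<in> H" "[a = h * x ^ j] (mod k)"
       "h' \<in> H" "[b = h' * x ^ j'] (mod k)" unfolding H'_def by blast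
    have c: "[a * b = (h * h') * x ^ (j + j')] (mod k)"
      using cong_mult[OF h(2,4)] by (simp add: power_add mult_ac)
    show "a * b \<in> H'" unfolding H'_def using D(4)[OF h(1,3)] c by blast
    show "\<chi>' (a * b) = \<chi>' a * \<chi>' b"
      using val[OF D(4)[OF h(1,3)] c] val[OF h(1,2)] val[OF h(3,4)] D(5)[OF h(1,3)]
      by (simp add: power_add)
  next
    fix a b assume "a \<in> H'" "[a = b] (mod k)"
    then obtain h j where h: "h \<in> H" "[a = h * x ^ j] (mod k)" unfolding H'_def by blast
    have c: "[b = h * x ^ j] (mod k)" using h(2) \<open>[a = b] (mod k)\<close>
      using cong_sym cong_trans by blast
    show "b \<in> H'" unfolding H'_def using h(1) c by blast
    show "\<chi>' b = \<chi>' a" using val[OF h] val[OF h(1) c] by simp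
  qed
  moreover have "x \<in> H'" unfolding H'_def using D(2) by (auto intro!: bexI[of _ 1] exI[of _ 1])
  moreover have "\<chi>' x = z" using val[of 1 x 1] D(2,3) by simp
  moreover have "\<chi>' h = \<chi> h" if "h \<in> H" for h using val[of h h 0] that by simp
  ultimately show ?thesis using sub that by blast
qed

lemma complex_nth_root_exists:
  fixes w :: complex
  assumes "0 < m"
  obtains z where "z ^ m = w"
proof
  show "rcis (root m (norm w)) (Arg w / m) ^ m = w"
    using assms by (simp add: DeMoivre2 rcis_cmod_Arg)
qed

definition dchars :: "nat \<Rightarrow> (nat \<Rightarrow> complex) set" where
  "dchars k = {\<chi>. \<chi> 1 = 1 \<and> (\<forall>m n. \<chi> (m * n) = \<chi> m * \<chi> n) \<and>
     (\<forall>n. \<chi> (n mod k) = \<chi> n) \<and> (\<forall>n. \<chi> n \<noteq> 0 \<longleftrightarrow> coprime n k)}"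

lemma partial_char_total:
  assumes P: "partial_char k {n. coprime n k} \<chi>"
  shows "(\<lambda>n. if coprime n k then \<chi> n else 0) \<in> dchars k"
proof -
  note D = partial_charD[OF P]
  have nz: "\<chi> n \<noteq> 0" if "coprime n k" for n
  proof (cases "k = 0")
    case True
    thus ?thesis using that D(3) by simp
  next
    case False
    have "\<chi> n ^ totient k = \<chi> (n ^ totient k)"
      using partial_char_power(2)[OF P, of n] that by simp
    also have "\<dots> = 1"
      using D(7)[of 1 "n ^ totient k"] D(3) euler_theorem[OF that] cong_sym
      by (metis D(2) One_nat_def)
    finally show ?thesis using False by (auto simp: power_0_left)
  qed
  have md: "coprime (n mod k) k \<longleftrightarrow> coprime n k" for n
    by (metis coprime_iff_gcd_eq_1 gcd_mod_left gcd_0_nat mod_by_0)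
  have "\<chi> (n mod k) = \<chi> n" if "coprime n k" for n
    using D(7)[of n "n mod k"] that by simp
  thus ?thesis unfolding dchars_def
    using nz D(3) D(5) by (auto simp: md)
qed

text \<open>Start from the trivial character of the trivial subgroup, where \<open>x\<close> has
  order \<open>m > 1\<close>, and give \<open>x\<close> a primitive \<open>m\<close>-th root of
  unity as value. Among all subgroups carrying a character with this value at \<open>x\<close>, take
  one with the most residues below \<open>k\<close>; if it missed a unit, one more extension would
  enlarge it.\<close>

lemma dchars_separate:
  assumes k: "k > 0" and x: "coprime x k" and x1: "\<not> [x = 1] (mod k)"
  obtains \<chi> where "\<chi> \<in> dchars k" "\<chi> x \<noteq> 1"
proof -
  have ex: "\<exists>m>0. x ^ m \<in> H \<and> (\<forall>i. 0 < i \<longrightarrow> i < m \<longrightarrow> x ^ i \<notin> H)"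
    if P: "partial_char k H \<chi>" and x: "coprime x k" for H \<chi> x
  proof -
    have "[1 = x ^ totient k] (mod k)" using euler_theorem[OF x] by (rule cong_sym)
    hence "\<exists>m. 0 < m \<and> x ^ m \<in> H"
      using partial_charD(2,6)[OF P] k by (intro exI[of _ "totient k"]) auto
    from this[THEN LeastI_ex] not_less_Least show ?thesis by blast
  qed
  define H0 where "H0 = {h. [h = 1] (mod k)}"
  have P0: "partial_char k H0 (\<lambda>_. 1)"
    unfolding partial_char_def H0_def
  proof (intro conjI ballI allI impI)
    show "{h. [h = 1] (mod k)} \<subseteq> {n. coprime n k}"
      using cong_imp_coprime[OF cong_sym, of _ 1 k] by auto
  next
    fix m n assume "m \<in> {h. [h = 1] (mod k)}" "n \<in> {h. [h = 1] (mod k)}"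
    thus "m * n \<in> {h. [h = 1] (mod k)}" using cong_mult[of m 1 k n 1] by simp
  next
    fix m n assume "m \<in> {h. [h = 1] (mod k)}" "[m = n] (mod k)"
    thus "n \<in> {h. [h = 1] (mod k)}" using cong_trans[OF cong_sym] by blast
  qed auto
  obtain m where m: "0 < m" "x ^ m \<in> H0" "\<And>i. 0 < i \<Longrightarrow> i < m \<Longrightarrow> x ^ i \<notin> H0"
    using ex[OF P0 x] by blast
  have "m \<noteq> 1" using m(2) x1 by (auto simp: H0_def)
  hence m2: "m > 1" using m(1) by simp
  define z where "z = cis (2 * pi / m)"
  have z: "z ^ m = 1" using m(1) by (simp add: z_def DeMoivre)
  have z1: "z \<noteq> 1"
  proof
    assume "z = 1"
    hence "cos (2 * pi / m) = 1" by (simp add: z_def complex_eq_iff)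
    then obtain n :: int where "2 * pi / m = n * 2 * pi" by (auto simp: cos_one_2pi_int)
    hence "real_of_int n * m = 1" using m(1) by (simp add: field_simps)
    hence "n * int m = 1" by (metis of_int_eq_1_iff of_int_mult of_int_of_nat_eq)
    thus False using m2 by (auto simp: zmult_eq_1_iff)
  qed
  define Q where "Q = (\<lambda>H. \<exists>\<chi>. partial_char k H \<chi> \<and> x \<in> H \<and> \<chi> x = z)"
  have "\<exists>H. Q H"
    by (rule partial_char_extend[OF P0 x m z]) (auto simp: Q_def)
  moreover have "card (H \<inter> {..<k}) < Suc k" for H
    using card_mono[of "{..<k}" "H \<inter> {..<k}"] by simp
  ultimately obtain H where H: "Q H" "\<And>H'. Q H' \<Longrightarrow> card (H' \<inter> {..<k}) \<le> card (H \<inter> {..<k})"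
    using ex_has_greatest_nat[of Q _ "\<lambda>H. card (H \<inter> {..<k})" "Suc k"] by blast
  then obtain \<chi> where P: "partial_char k H \<chi>" "x \<in> H" "\<chi> x = z" unfolding Q_def by blast
  have "H = {n. coprime n k}"
  proof (rule ccontr)
    assume "H \<noteq> {n. coprime n k}"
    then obtain y where y: "coprime y k" "y \<notin> H" using partial_charD(1)[OF P(1)] by blast
    obtain l where l: "0 < l" "y ^ l \<in> H" "\<And>i. 0 < i \<Longrightarrow> i < l \<Longrightarrow> y ^ i \<notin> H"
      using ex[OF P(1) y(1)] by blast
    obtain w where w: "w ^ l = \<chi> (y ^ l)" using complex_nth_root_exists[OF l(1)] by blast
    obtain H' \<chi>' where H': "partial_char k H' \<chi>'" "H \<subseteq> H'" "y \<in> H'" "\<chi>' y = w"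
      "\<And>h. h \<in> H \<Longrightarrow> \<chi>' h = \<chi> h"
      by (rule partial_char_extend[OF P(1) y(1) l w]) (assumption | rule that)+
    have "Q H'" unfolding Q_def using H' P by auto
    moreover have "card (H \<inter> {..<k}) < card (H' \<inter> {..<k})"
    proof (rule psubset_card_mono)
      have "y mod k \<in> H'" using partial_charD(6)[OF H'(1,3)] by simp
      moreover have "y mod k \<notin> H"
        using partial_charD(6)[OF P(1), of "y mod k" y] y(2) by auto
      ultimately show "H \<inter> {..<k} \<subset> H' \<inter> {..<k}" using H'(2) k by auto
    qed auto
    ultimately show False using H(2)[of H'] by simp
  qed
  hence "(\<lambda>n. if coprime n k then \<chi> n else 0) \<in> dchars k"
    using partial_char_total P(1) by blast
  thus ?thesis using that P(3) z1 x by force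
qed

section \<open>Dirichlet characters and orthogonality\<close>

lemma dcharsD:
  assumes "\<chi> \<in> dchars k"
  shows "\<chi> (Suc 0) = 1" "\<chi> (m * n) = \<chi> m * \<chi> n" "\<chi> (n mod k) = \<chi> n"
    "\<chi> n = 0 \<longleftrightarrow> \<not> coprime n k"
  using assms unfolding dchars_def by auto

lemma dchars_power:
  assumes "\<chi> \<in> dchars k"
  shows "\<chi> (n ^ j) = \<chi> n ^ j"
  by (induction j) (simp_all add: dcharsD[OF assms])

lemma dchars_cong:
  assumes "\<chi> \<in> dchars k" "[m = n] (mod k)"
  shows "\<chi> m = \<chi> n"
  using dcharsD(3)[OF assms(1)] assms(2) unfolding cong_def by metis

lemma dchars_root_of_unity:
  assumes "\<chi> \<in> dchars k" "coprime n k"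
  shows "\<chi> n ^ totient k = 1"
proof -
  have "\<chi> n ^ totient k = \<chi> (n ^ totient k)" by (simp add: dchars_power[OF assms(1)])
  also have "\<dots> = \<chi> (Suc 0)"
    using dchars_cong[OF assms(1) euler_theorem[OF assms(2)]] by simp
  finally show ?thesis by (simp add: dcharsD[OF assms(1)])
qed

lemma norm_dchars:
  assumes "\<chi> \<in> dchars k" "k > 0" "coprime n k"
  shows "norm (\<chi> n) = 1"
proof -
  have "norm (\<chi> n) ^ totient k = 1 ^ totient k"
    using dchars_root_of_unity[OF assms(1,3)] by (simp add: norm_power[symmetric])
  thus ?thesis using assms(2) power_eq_iff_eq_base[of "totient k" "norm (\<chi> n)" 1] by simp
qed

lemma norm_dchars_le:
  assumes "\<chi> \<in> dchars k" "k > 0"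
  shows "norm (\<chi> n) \<le> 1"
  using norm_dchars[OF assms, of n] dcharsD(4)[OF assms(1), of n] by (cases "coprime n k") auto

text \<open>A character is determined by its values below \<open>k\<close>, and each value is 0 or a
  root of unity of order dividing \<open>totient k\<close>.\<close>

lemma finite_dchars:
  assumes "k > 0"
  shows "finite (dchars k)"
proof (rule inj_on_finite)
  let ?R = "insert 0 {z :: complex. z ^ totient k = 1}"
  show "inj_on (\<lambda>\<chi>. restrict \<chi> {..<k}) (dchars k)"
  proof (rule inj_onI)
    fix \<chi> \<psi> assume *: "\<chi> \<in> dchars k" "\<psi> \<in> dchars k" "restrict \<chi> {..<k} = restrict \<psi> {..<k}"
    show "\<chi> = \<psi>"
    proof
      fix n
      have "n mod k \<in> {..<k}" using assms by simp
      hence "\<chi> (n mod k) = \<psi> (n mod k)" using *(3) by (metis restrict_apply')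
      thus "\<chi> n = \<psi> n" using dcharsD(3)[OF *(1), of n] dcharsD(3)[OF *(2), of n] by simp
    qed
  qed
  show "(\<lambda>\<chi>. restrict \<chi> {..<k}) ` dchars k \<subseteq> PiE {..<k} (\<lambda>_. ?R)"
  proof
    fix f assume "f \<in> (\<lambda>\<chi>. restrict \<chi> {..<k}) ` dchars k"
    then obtain \<chi> where c: "\<chi> \<in> dchars k" "f = restrict \<chi> {..<k}" by blast
    have "\<chi> n \<in> ?R" for n
      using dchars_root_of_unity[OF c(1), of n] dcharsD(4)[OF c(1), of n] by auto
    thus "f \<in> PiE {..<k} (\<lambda>_. ?R)" using c(2) by auto
  qed
  show "finite (PiE {..<k} (\<lambda>_. ?R))"
    using assms by (intro finite_PiE) (auto intro!: finite_roots_unity simp: Suc_le_eq)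
qed

lemma dchars_mult:
  assumes "\<chi> \<in> dchars k" "\<psi> \<in> dchars k"
  shows "(\<lambda>n. \<chi> n * \<psi> n) \<in> dchars k"
  using assms unfolding dchars_def by (simp add: mult_ac)

lemma dchars_cnj:
  assumes "\<chi> \<in> dchars k"
  shows "(\<lambda>n. cnj (\<chi> n)) \<in> dchars k"
  using assms unfolding dchars_def by simp

definition principal_dchar :: "nat \<Rightarrow> nat \<Rightarrow> complex" where
  "principal_dchar k n = (if coprime n k then 1 else 0)"

lemma principal_dchar_in_dchars: "principal_dchar k \<in> dchars k"
proof -
  have "coprime (n mod k) k \<longleftrightarrow> coprime n k" for n
    by (metis coprime_iff_gcd_eq_1 gcd_mod_left gcd_0_nat mod_by_0)
  thus ?thesis unfolding dchars_def principal_dchar_def by auto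
qed

text \<open>Multiplication by a character \<open>\<psi>\<close> with
  \<open>\<psi> n \<noteq> 1\<close> permutes the characters and so multiplies the sum by
  \<open>\<psi> n\<close>, which forces the sum to be 0.\<close>

lemma sum_dchars:
  assumes k: "k > 0" and n: "coprime n k"
  shows "(\<Sum>\<chi>\<in>dchars k. \<chi> n) = (if [n = 1] (mod k) then of_nat (card (dchars k)) else 0)"
proof (cases "[n = 1] (mod k)")
  case True
  have "\<chi> n = 1" if "\<chi> \<in> dchars k" for \<chi>
    using dchars_cong[OF that True] dcharsD(1)[OF that] by simp
  hence "(\<Sum>\<chi>\<in>dchars k. \<chi> n) = (\<Sum>\<chi>\<in>dchars k. 1)" by (rule sum.cong[OF refl])
  thus ?thesis using True by simp
next
  case False
  obtain \<psi> where \<psi>: "\<psi> \<in> dchars k" "\<psi> n \<noteq> 1" using dchars_separate[OF k n False] .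
  let ?T = "\<lambda>\<chi> m. \<psi> m * \<chi> m"
  have "inj_on ?T (dchars k)"
  proof (rule inj_onI)
    fix \<chi> \<chi>' assume *: "\<chi> \<in> dchars k" "\<chi>' \<in> dchars k" "?T \<chi> = ?T \<chi>'"
    show "\<chi> = \<chi>'"
    proof
      fix m
      have "\<psi> m * \<chi> m = \<psi> m * \<chi>' m" using *(3) by meson
      thus "\<chi> m = \<chi>' m"
        using dcharsD(4)[OF \<psi>(1), of m] dcharsD(4)[OF *(1), of m] dcharsD(4)[OF *(2), of m]
        by (cases "coprime m k") auto
    qed
  qed
  moreover have "?T ` dchars k \<subseteq> dchars k" using dchars_mult[OF \<psi>(1)] by blast
  ultimately have "bij_betw ?T (dchars k) (dchars k)"
    using endo_inj_surj[OF finite_dchars[OF k]] by (auto simp: bij_betw_def)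
  from sum.reindex_bij_betw[OF this, of "\<lambda>\<chi>. \<chi> n"]
  have "\<psi> n * (\<Sum>\<chi>\<in>dchars k. \<chi> n) = (\<Sum>\<chi>\<in>dchars k. \<chi> n)"
    by (simp add: sum_distrib_left)
  thus ?thesis using \<psi>(2) False by simp
qed

text \<open>Dual to the previous argument: multiplication by a unit \<open>b\<close> with
  \<open>\<chi> b \<noteq> 1\<close> permutes the residues.\<close>

lemma sum_nonprincipal_dchar:
  assumes k: "k > 0" and \<chi>: "\<chi> \<in> dchars k" "\<chi> \<noteq> principal_dchar k"
  shows "(\<Sum>n=1..k. \<chi> n) = 0"
proof -
  obtain b where b: "\<chi> b \<noteq> principal_dchar k b" using \<chi>(2) by blast
  hence cb: "coprime b k" and b1: "\<chi> b \<noteq> 1"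
    using dcharsD(4)[OF \<chi>(1), of b] by (auto simp: principal_dchar_def split: if_splits)
  let ?f = "\<lambda>n. b * n mod k"
  have "inj_on ?f {..<k}"
  proof (rule inj_onI)
    fix x y assume *: "x \<in> {..<k}" "y \<in> {..<k}" "b * x mod k = b * y mod k"
    hence "[b * x = b * y] (mod k)" by (simp add: cong_def)
    hence "[x = y] (mod k)" using cb by (simp add: cong_mult_lcancel_nat)
    thus "x = y" using * by (simp add: cong_less_modulus_unique_nat)
  qed
  moreover have "?f ` {..<k} \<subseteq> {..<k}" using k by auto
  ultimately have "bij_betw ?f {..<k} {..<k}"
    using endo_inj_surj[of "{..<k}" ?f] by (auto simp: bij_betw_def)
  from sum.reindex_bij_betw[OF this, of \<chi>]
  have "\<chi> b * (\<Sum>n<k. \<chi> n) = (\<Sum>n<k. \<chi> n)"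
    by (simp add: sum_distrib_left dcharsD[OF \<chi>(1)])
  hence "(\<Sum>n<k. \<chi> n) = 0" using b1 by simp
  moreover have "(\<Sum>n<k. \<chi> n) = (\<Sum>n=1..k. \<chi> n)"
  proof -
    have "(\<Sum>n<k. \<chi> n) + \<chi> k = (\<Sum>n\<le>k. \<chi> n)" by (simp add: lessThan_Suc_atMost[symmetric])
    also have "\<dots> = \<chi> 0 + (\<Sum>n=1..k. \<chi> n)"
      by (simp add: atMost_atLeast0 sum.atLeast_Suc_atMost)
    also have "\<chi> 0 = \<chi> k" using dcharsD(3)[OF \<chi>(1), of k] by simp
    finally show ?thesis by simp
  qed
  ultimately show ?thesis by simp
qed

text \<open>By periodicity the difference does not change when \<open>N\<close> grows by
  \<open>k\<close>, so it suffices to treat \<open>N < k\<close>, where both terms are at most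
  \<open>N\<close> in norm. The principal and nonprincipal cases are covered together; in the latter
  the mean is 0.\<close>

lemma norm_sum_dchar_minus_mean:
  assumes k: "k > 0" and \<chi>: "\<chi> \<in> dchars k"
  shows "norm ((\<Sum>n=1..N. \<chi> n) - of_nat N * ((\<Sum>n=1..k. \<chi> n) / of_nat k)) \<le> 2 * real k"
proof -
  define c where "c = (\<Sum>n=1..k. \<chi> n) / of_nat k"
  have bd: "norm (\<Sum>n=1..N. \<chi> n) \<le> real N" for N
    using sum_norm_le[of "{1..N}" \<chi> "\<lambda>_. 1"] norm_dchars_le[OF \<chi> k] by simp
  have c1: "norm c \<le> 1"
    unfolding c_def using bd[of k] k by (simp add: norm_divide)
  have per: "(\<Sum>n=1..N + k. \<chi> n) = (\<Sum>n=1..N. \<chi> n) + (\<Sum>n=1..k. \<chi> n)" for N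
  proof (induction N)
    case (Suc N)
    have "\<chi> (Suc N + k) = \<chi> (Suc N)"
      by (rule dchars_cong[OF \<chi>]) (simp add: cong_def add_Suc[symmetric] del: add_Suc)
    thus ?case using Suc by simp
  qed simp
  have "norm ((\<Sum>n=1..N. \<chi> n) - of_nat N * c) \<le> 2 * real k"
  proof (induction N rule: less_induct)
    case (less N)
    show ?case
    proof (cases "N < k")
      case True
      have "norm ((\<Sum>n=1..N. \<chi> n) - of_nat N * c) \<le> norm (\<Sum>n=1..N. \<chi> n) + real N * norm c"
        by (rule order.trans[OF norm_triangle_ineq4]) (simp add: norm_mult)
      also have "\<dots> \<le> real N + real N * 1"
        by (intro add_mono bd mult_left_mono c1) auto
      finally show ?thesis using True by simp
    next
      case False
      then obtain M where M: "N = M + k" by (metis add.commute le_Suc_ex not_less)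
      have "of_nat k * c = (\<Sum>n=1..k. \<chi> n)" unfolding c_def using k by simp
      hence "(\<Sum>n=1..N. \<chi> n) - of_nat N * c = (\<Sum>n=1..M. \<chi> n) - of_nat M * c"
        unfolding M per by (simp add: algebra_simps)
      thus ?thesis using less[of M] M k by simp
    qed
  qed
  thus ?thesis by (simp add: c_def)
qed

section \<open>Arithmetic functions and partial summation\<close>

text \<open>Both sides run over the pairs \<open>(d, m)\<close> with
  \<open>d * m \<le> N\<close>.\<close>

lemma sum_divisors_hyperbola:
  fixes F :: "nat \<Rightarrow> nat \<Rightarrow> 'a :: comm_monoid_add"
  shows "(\<Sum>n=1..N. \<Sum>d | d dvd n. F d (n div d)) = (\<Sum>d=1..N. \<Sum>m=1..N div d. F d m)"
proof -
  have aux: "0 < d \<and> d \<le> n" if "d dvd n" "0 < n" for d n :: nat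
    using that by (simp add: dvd_imp_le dvd_pos_nat)
  have "(\<Sum>n=1..N. \<Sum>d | d dvd n. F d (n div d)) =
        (\<Sum>(n, d)\<in>(SIGMA n:{1..N}. {d. d dvd n}). F d (n div d))"
    by (subst sum.Sigma) (auto intro: finite_divisors_nat)
  also have "\<dots> = (\<Sum>(d, m)\<in>(SIGMA d:{1..N}. {1..N div d}). F d m)"
    by (rule sum.reindex_bij_witness[of _ "\<lambda>(d, m). (d * m, d)" "\<lambda>(n, d). (d, n div d)"])
       (auto simp: Suc_le_eq dvd_imp_le div_greater_zero_iff div_le_mono
             less_eq_div_iff_mult_less_eq mult.commute dest: aux)
  also have "\<dots> = (\<Sum>d=1..N. \<Sum>m=1..N div d. F d m)"
    by (subst sum.Sigma) auto
  finally show ?thesis .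
qed

text \<open>Both sides run over the pairs with \<open>d * e dvd n\<close>, a symmetric
  condition.\<close>

lemma sum_divisors_divisors_swap:
  fixes F :: "nat \<Rightarrow> nat \<Rightarrow> 'a :: comm_monoid_add"
  assumes n: "n > 0"
  shows "(\<Sum>d | d dvd n. \<Sum>e | e dvd n div d. F d e) = (\<Sum>e | e dvd n. \<Sum>d | d dvd n div e. F d e)"
proof -
  have 1: "d dvd n \<and> e dvd n div d \<longleftrightarrow> d * e dvd n" for d e
    using n by (metis dvd_div_iff_mult dvd_mult_left dvd_0_left_iff mult.commute neq0_conv)
  have 2: "e dvd n" "d dvd n div e" if "d dvd n" "e dvd n div d" for d e
    using 1[of d e] 1[of e d] that by (auto simp: mult.commute)
  have fin: "finite {e. e dvd n div d}" if "d dvd n" for d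
    using that n by (intro finite_divisors_nat) (auto simp: div_greater_zero_iff dvd_imp_le dvd_pos_nat)
  have "(\<Sum>d | d dvd n. \<Sum>e | e dvd n div d. F d e) =
        (\<Sum>(d, e)\<in>(SIGMA d:{d. d dvd n}. {e. e dvd n div d}). F d e)"
    using n fin by (subst sum.Sigma) auto
  also have "\<dots> = (\<Sum>(e, d)\<in>(SIGMA e:{e. e dvd n}. {d. d dvd n div e}). F d e)"
    by (rule sum.reindex_bij_witness[of _ "\<lambda>(e, d). (d, e)" "\<lambda>(d, e). (e, d)"])
       (auto intro: 2)
  also have "\<dots> = (\<Sum>e | e dvd n. \<Sum>d | d dvd n div e. F d e)"
    using n fin by (subst sum.Sigma) auto
  finally show ?thesis .
qed

section \<open>The Moebius function and its convolution with the logarithm\<close>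

definition moebius_mu :: "nat \<Rightarrow> real" where
  "moebius_mu n = (if squarefree n then (-1) ^ card (prime_factors n) else 0)"

lemma abs_moebius_mu_le: "\<bar>moebius_mu n\<bar> \<le> 1"
  by (simp add: moebius_mu_def power_abs)

text \<open>Fix a prime \<open>p\<close> dividing \<open>n\<close>. The squarefree divisors fall
  into pairs \<open>d\<close>, \<open>p * d\<close> with \<open>d\<close> not divisible by
  \<open>p\<close>, and the two signs in a pair cancel.\<close>

lemma sum_moebius_mu:
  assumes n: "n > 0"
  shows "(\<Sum>d | d dvd n. moebius_mu d) = (if n = 1 then 1 else 0)"
proof (cases "n = 1")
  case True
  thus ?thesis by (simp add: moebius_mu_def)
next
  case False
  then obtain p where p: "prime p" "p dvd n" using prime_factor_nat by blast
  define A where "A = {d. d dvd n \<and> squarefree d \<and> \<not> p dvd d}"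
  have fA: "finite A" unfolding A_def by (rule finite_subset[of _ "{d. d dvd n}"]) (use n in auto)
  have inj: "inj_on ((*) p) A" using p by (auto simp: inj_on_def)
  have cop: "coprime p d" if "d \<in> A" for d
    using that p(1) by (auto simp: A_def prime_imp_coprime)
  have "{d. d dvd n \<and> squarefree d} = A \<union> (*) p ` A"
  proof (intro equalityI subsetI)
    fix d assume d: "d \<in> {d. d dvd n \<and> squarefree d}"
    show "d \<in> A \<union> (*) p ` A"
    proof (cases "p dvd d")
      case True
      then obtain e where e: "d = p * e" by (elim dvdE)
      have "\<not> p dvd e"
      proof
        assume "p dvd e"
        hence "p ^ 2 dvd d" by (auto simp: e power2_eq_square)
        hence "is_unit p" using d by (auto simp: squarefree_def)
        thus False using p(1) by simp
      qed
      moreover have "e dvd n" using d e by (auto intro: dvd_trans[of e d n])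
      moreover have "squarefree e" using d e squarefree_mono[of e d] by auto
      ultimately show ?thesis using e by (auto simp: A_def)
    qed (use d in \<open>auto simp: A_def\<close>)
  next
    fix d assume "d \<in> A \<union> (*) p ` A"
    thus "d \<in> {d. d dvd n \<and> squarefree d}"
    proof
      assume "d \<in> (*) p ` A"
      then obtain e where e: "e \<in> A" "d = p * e" by blast
      have "squarefree d" using e cop[OF e(1)] p(1)
        by (auto simp: A_def squarefree_mult_coprime squarefree_prime)
      moreover have "d dvd n" using e cop[OF e(1)] p(2) by (auto simp: A_def intro: divides_mult)
      ultimately show ?thesis by simp
    qed (auto simp: A_def)
  qed
  moreover have "(\<Sum>d | d dvd n. moebius_mu d) = (\<Sum>d | d dvd n \<and> squarefree d. moebius_mu d)"
    by (rule sum.mono_neutral_right) (use n in \<open>auto simp: moebius_mu_def\<close>)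
  ultimately have "(\<Sum>d | d dvd n. moebius_mu d) = (\<Sum>d\<in>A \<union> (*) p ` A. moebius_mu d)" by simp
  also have "\<dots> = (\<Sum>d\<in>A. moebius_mu d) + (\<Sum>d\<in>(*) p ` A. moebius_mu d)"
    using fA by (intro sum.union_disjoint) (auto simp: A_def)
  also have "(\<Sum>d\<in>(*) p ` A. moebius_mu d) = (\<Sum>d\<in>A. moebius_mu (p * d))"
    using inj by (simp add: sum.reindex)
  also have "\<dots> = (\<Sum>d\<in>A. - moebius_mu d)"
  proof (rule sum.cong[OF refl])
    fix d assume d: "d \<in> A"
    have d0: "d \<noteq> 0" using d n by (auto simp: A_def)
    have "squarefree (p * d)" using d cop[OF d] p(1)
      by (auto simp: A_def squarefree_mult_coprime squarefree_prime)
    moreover have "prime_factors (p * d) = insert p (prime_factors d)"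
      using d0 p(1) by (subst prime_factors_product) (auto simp: prime_prime_factors)
    moreover have "p \<notin> prime_factors d" using d by (auto simp: A_def)
    ultimately show "moebius_mu (p * d) = - moebius_mu d"
      using d by (simp add: moebius_mu_def A_def)
  qed
  finally show ?thesis using False by (simp add: sum_negf)
qed

text \<open>Split \<open>ln (x / d)\<close> as \<open>ln (n / d) + (ln x - ln n)\<close>. Moebius
  inversion of \<open>ln\<close> as the divisor sum of \<open>\<Lambda>\<close> handles the first
  part; the second is constant in \<open>d\<close>, so it survives only for \<open>n = 1\<close>,
  where \<open>ln n = 0\<close>.\<close>

lemma sum_moebius_mu_ln:
  assumes n: "n > 0" and x: "x > 0"
  shows "(\<Sum>d | d dvd n. moebius_mu d * ln (x / real d)) = mangoldt n + (if n = 1 then ln x else 0)"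
proof -
  have pos: "d > 0" if "d dvd n" for d using that n dvd_pos_nat by blast
  have "(\<Sum>d | d dvd n. moebius_mu d * ln (x / real d)) =
        (\<Sum>d | d dvd n. moebius_mu d * ln (real (n div d)) + moebius_mu d * (ln x - ln n))"
  proof (rule sum.cong[OF refl])
    fix d assume "d \<in> {d. d dvd n}"
    hence d: "d dvd n" by simp
    have e: "ln (real (n div d)) = ln n - ln d" using n pos[OF d] d by (simp add: real_of_nat_div ln_div)
    show "moebius_mu d * ln (x / real d) = moebius_mu d * ln (real (n div d)) + moebius_mu d * (ln x - ln n)"
      using x pos[OF d] by (simp only: e ln_div of_nat_0_less_iff) (simp add: algebra_simps)
  qed
  also have "\<dots> = (\<Sum>d | d dvd n. moebius_mu d * ln (real (n div d))) +
      (\<Sum>d | d dvd n. moebius_mu d) * (ln x - ln n)"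
    by (simp add: sum.distrib sum_distrib_right)
  also have "(\<Sum>d | d dvd n. moebius_mu d * ln (real (n div d))) =
      (\<Sum>d | d dvd n. \<Sum>e | e dvd n div d. moebius_mu d * mangoldt e)"
  proof (rule sum.cong[OF refl])
    fix d assume "d \<in> {d. d dvd n}"
    hence "n div d \<noteq> 0" using n pos by (auto simp: div_eq_0_iff dest: dvd_imp_le)
    from mangoldt_sum[OF this, where ?'a = real]
    show "moebius_mu d * ln (real (n div d)) = (\<Sum>e | e dvd n div d. moebius_mu d * mangoldt e)"
      by (simp only: sum_distrib_left[symmetric]) simp
  qed
  also have "\<dots> = (\<Sum>e | e dvd n. (\<Sum>d | d dvd n div e. moebius_mu d) * mangoldt e)"
    by (subst sum_divisors_divisors_swap[OF n]) (simp add: sum_distrib_right)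
  also have "\<dots> = (\<Sum>e | e dvd n. if e = n then mangoldt e else 0)"
  proof (rule sum.cong[OF refl])
    fix e assume "e \<in> {e. e dvd n}"
    hence e: "e dvd n" by simp
    hence "n div e > 0" using n pos by (auto simp: div_greater_zero_iff dvd_imp_le)
    moreover have "n div e = 1 \<longleftrightarrow> e = n" using e n pos[OF e] by (auto elim!: dvdE)
    ultimately show "(\<Sum>d | d dvd n div e. moebius_mu d) * mangoldt e = (if e = n then mangoldt e else 0)"
      by (simp add: sum_moebius_mu)
  qed
  also have "\<dots> = mangoldt n" using n by (simp add: sum.delta)
  finally show ?thesis using sum_moebius_mu[OF n] by simp
qed

section \<open>Chebyshev's upper bound\<close>

lemma sum_ln_eq_sum_mangoldt:
  "(\<Sum>n=1..N. ln (real n)) = (\<Sum>d=1..N. mangoldt d * real (N div d))"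
proof -
  have "(\<Sum>n=1..N. ln (real n)) = (\<Sum>n=1..N. \<Sum>d | d dvd n. mangoldt d)"
    using mangoldt_sum[where ?'a = real] by (intro sum.cong) auto
  also have "\<dots> = (\<Sum>d=1..N. \<Sum>m=1..N div d. mangoldt d)"
    by (rule sum_divisors_hyperbola)
  finally show ?thesis by (simp add: mult.commute)
qed

text \<open>The logarithm of the central binomial coefficient is the sum of
  \<open>\<Lambda>(n)\<close> with weight \<open>2 * N div n - 2 * (N div n)\<close>. The weights
  are nonnegative, and at least 1 for \<open>N < n \<le> 2 * N\<close>; the binomial coefficient is
  at most \<open>2 ^ (2 * N)\<close>.\<close>

lemma sum_mangoldt_double:
  "(\<Sum>n=1..2*N. mangoldt n :: real) \<le> (\<Sum>n=1..N. mangoldt n) + real (2 * N) * ln 2"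
proof -
  have T: "(\<Sum>n=1..M. ln (real n)) = ln (fact M)" for M
    by (induction M) (auto simp: ln_mult)
  have "(\<Sum>n=1..2*N. mangoldt n :: real) - (\<Sum>n=1..N. mangoldt n) = (\<Sum>n=1..2*N. mangoldt n * (if N < n then 1 else 0))"
  proof -
    have "(\<Sum>n=1..N. mangoldt n :: real) = (\<Sum>n=1..2*N. mangoldt n * (if N < n then 0 else 1))"
      by (rule sum.mono_neutral_cong_left) auto
    thus ?thesis by (simp add: sum_subtractf[symmetric] if_distrib cong: if_cong)
  qed
  also have "\<dots> \<le> (\<Sum>n=1..2*N. mangoldt n * (real (2 * N div n) - 2 * real (N div n)))"
  proof (intro sum_mono mult_left_mono mangoldt_nonneg)
    fix n assume n: "n \<in> {1..2*N}"
    have "2 * (N div n) \<le> 2 * N div n"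
      using n by (metis div_times_less_eq_dividend less_eq_div_iff_mult_less_eq mult.assoc mult_le_mono2 atLeastAtMost_iff less_eq_Suc_le One_nat_def)
    moreover have "2 * N div n \<ge> 1" using n by (simp add: Suc_le_eq div_greater_zero_iff)
    moreover have "N div n = 0" if "N < n" using that by simp
    ultimately show "(if N < n then 1 else 0) \<le> real (2 * N div n) - 2 * real (N div n)"
      by (auto simp: of_nat_diff[symmetric])
  qed
  also have "\<dots> = (\<Sum>n=1..2*N. ln (real n)) - 2 * (\<Sum>d=1..2*N. mangoldt d * real (N div d))"
    unfolding sum_ln_eq_sum_mangoldt by (simp add: sum_subtractf sum_distrib_left algebra_simps)
  also have "(\<Sum>d=1..2*N. mangoldt d * real (N div d)) = (\<Sum>n=1..N. ln (real n))"
    unfolding sum_ln_eq_sum_mangoldt by (rule sum.mono_neutral_right) auto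
  also have "(\<Sum>n=1..2*N. ln (real n)) - 2 * (\<Sum>n=1..N. ln (real n)) = ln (real ((2 * N) choose N))"
  proof -
    have "real ((2 * N) choose N) = fact (2 * N) / (fact N * fact N)"
      by (simp add: binomial_fact)
    thus ?thesis unfolding T by (simp add: ln_div ln_mult)
  qed
  also have "\<dots> \<le> ln (2 ^ (2 * N))"
  proof -
    have "(2 * N) choose N \<le> 2 ^ (2 * N)"
      unfolding choose_row_sum[symmetric] by (rule member_le_sum) auto
    hence "real ((2 * N) choose N) \<le> 2 ^ (2 * N)"
      by (metis of_nat_le_iff of_nat_numeral of_nat_power)
    thus ?thesis by (subst ln_le_cancel_iff) auto
  qed
  also have "\<dots> = real (2 * N) * ln 2" by (subst ln_realpow) auto
  finally show ?thesis by simp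
qed

lemma chebyshev_upper_bound: "(\<Sum>n=1..N. mangoldt n) \<le> 4 * real N"
proof (induction N rule: less_induct)
  case (less N)
  show ?case
  proof (cases "N \<le> 1")
    case True
    thus ?thesis by (cases N) auto
  next
    case False
    define M where "M = N div 2"
    have M: "M < N" "M \<ge> 1" using False by (auto simp: M_def)
    \<comment> \<open>Doubling costs \<open>4 * M + 2 * M\<close>, while the constant 4 allows
      \<open>8 * M\<close>; the slack of \<open>2 * M\<close> pays for the extra term when
      \<open>N\<close> is odd.\<close>
    have "real (2 * M) * ln 2 \<le> 2 * M"
      using ln_2_less_1 by (simp add: mult_left_le)
    hence 1: "(\<Sum>n=1..2*M. mangoldt n :: real) \<le> 6 * M"
      using sum_mangoldt_double[of M] less[OF M(1)] by simp
    have "N = 2 * M \<or> N = Suc (2 * M)" unfolding M_def by presburger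
    thus ?thesis
    proof
      assume N: "N = Suc (2 * M)"
      have "mangoldt (Suc (2 * M)) \<le> ln (1 + real (2 * M))" using mangoldt_le[of "Suc (2 * M)"] by simp
      also have "\<dots> \<le> real (2 * M)" by (rule ln_add_one_self_le_self) simp
      finally show ?thesis using 1 N by simp
    qed (use 1 in simp)
  qed
qed

text \<open>From \<open>N\<close> to \<open>N + 1\<close> each of the \<open>N\<close> old terms
  grows by \<open>ln (1 + 1 / N) \<le> 1 / N\<close>, and the new term is \<open>ln 1 = 0\<close>;
  the sum grows by at most 1.\<close>

lemma sum_ln_quotient_le: "(\<Sum>d=1..N. ln (real N / real d)) \<le> real N"
proof (induction N)
  case (Suc N)
  show ?case
  proof (cases "N = 0")
    case False
    have "(\<Sum>d=1..Suc N. ln (real (Suc N) / real d)) = (\<Sum>d=1..N. ln (real (Suc N) / real d))" by simp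
    also have "\<dots> = (\<Sum>d=1..N. ln (real N / real d) + (ln (real (Suc N)) - ln (real N)))"
      using False by (intro sum.cong) (auto simp: ln_div)
    also have "\<dots> = (\<Sum>d=1..N. ln (real N / real d)) + N * (ln (real (Suc N)) - ln (real N))"
      by (simp add: sum.distrib)
    also have "ln (real (Suc N)) - ln (real N) \<le> 1 / N"
    proof -
      have "ln (real (Suc N)) - ln (real N) = ln (1 + 1 / N)"
        using ln_div[of "real (Suc N)" "real N"] False by (simp add: add_divide_distrib add.commute)
      also have "\<dots> \<le> 1 / N" by (rule ln_add_one_self_le_self) simp
      finally show ?thesis .
    qed
    finally show ?thesis using Suc False by (simp add: mult_left_mono)
  qed simp
qed simp

text \<open>Abel summation: the weights \<open>f i - f (Suc i)\<close> together with the last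
  \<open>f n\<close> are nonnegative and add up to \<open>f m\<close>.\<close>

lemma norm_sum_antimono_le:
  fixes a :: "nat \<Rightarrow> complex" and f :: "nat \<Rightarrow> real"
  assumes B: "\<And>n. norm (\<Sum>i=m..n. a i) \<le> B"
  and f: "\<And>n. n \<ge> m \<Longrightarrow> f (Suc n) \<le> f n" "\<And>n. n \<ge> m \<Longrightarrow> 0 \<le> f n"
  shows "norm (\<Sum>i=m..n. of_real (f i) * a i) \<le> B * f m"
proof (cases "m \<le> n")
  case True
  define S where "S = (\<lambda>n. \<Sum>i=m..n. a i)"
  have "(\<Sum>i=m..n. of_real (f i) * a i) =
      of_real (f n) * S n + (\<Sum>i=m..<n. of_real (f i - f (Suc i)) * S i)"
    using True by (induction n rule: dec_induct) (simp_all add: S_def algebra_simps)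
  also have "norm \<dots> \<le> f n * B + (\<Sum>i=m..<n. (f i - f (Suc i)) * B)"
    using True B f unfolding S_def
    by (intro order.trans[OF norm_triangle_ineq] add_mono order.trans[OF norm_sum] sum_mono)
       (auto simp del: of_real_diff simp: norm_mult intro!: mult_left_mono)
  also have "\<dots> = (f n + (\<Sum>i=m..<n. f i - f (Suc i))) * B"
    by (simp only: sum_distrib_right[symmetric] distrib_right)
  also have "(\<Sum>i=m..<n. f i - f (Suc i)) = f m - f n"
    using True by (induction n rule: dec_induct) auto
  finally show ?thesis by (simp add: mult.commute)
next
  case False
  have "B \<ge> 0" using B[of 0] norm_ge_zero order.trans by blast
  thus ?thesis using False f(2)[of m] by simp
qed

section \<open>The Mangoldt function weighted by a character\<close>

text \<open>A difference of two initial sums, each at most \<open>2 * k\<close> in norm because the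
  mean is 0. This is the input for all partial summations below.\<close>

lemma norm_sum_dchar_le:
  assumes k: "k > 0" and \<chi>: "\<chi> \<in> dchars k" "\<chi> \<noteq> principal_dchar k" and m: "m \<ge> 1"
  shows "norm (\<Sum>i=m..n. \<chi> i) \<le> 4 * real k"
proof (cases "m \<le> n")
  case True
  have b: "norm (\<Sum>i=1..n. \<chi> i) \<le> 2 * real k" for n
    using norm_sum_dchar_minus_mean[OF k \<chi>(1), of n] sum_nonprincipal_dchar[OF k \<chi>] by simp
  have "{1..n} = {1..m - 1} \<union> {m..n}" using True m by auto
  hence "(\<Sum>i=1..n. \<chi> i) = (\<Sum>i=1..m - 1. \<chi> i) + (\<Sum>i=m..n. \<chi> i)"
    by (simp only:) (rule sum.union_disjoint, use m in auto)
  hence "(\<Sum>i=m..n. \<chi> i) = (\<Sum>i=1..n. \<chi> i) - (\<Sum>i=1..m - 1. \<chi> i)" by simp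
  also have "norm \<dots> \<le> 2 * real k + 2 * real k"
    by (intro order.trans[OF norm_triangle_ineq4] add_mono b)
  finally show ?thesis by simp
qed simp

lemma norm_sum_dchar_over_le:
  assumes "k > 0" "\<chi> \<in> dchars k" "\<chi> \<noteq> principal_dchar k" "m \<ge> 1"
  shows "norm (\<Sum>i=m..n. \<chi> i / of_nat i) \<le> 4 * real k / real m"
proof -
  have "norm (\<Sum>i=m..n. of_real (1 / real i) * \<chi> i) \<le> 4 * real k * (1 / real m)"
    using assms(4) by (intro norm_sum_antimono_le norm_sum_dchar_le assms) (auto simp: field_simps)
  thus ?thesis by (simp add: field_simps)
qed

text \<open>The term for \<open>n = 0\<close> is 0 because of \<open>x / 0 = 0\<close>.\<close>

definition dirichlet_L1 :: "(nat \<Rightarrow> complex) \<Rightarrow> complex" where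
  "dirichlet_L1 \<chi> = (\<Sum>n. \<chi> n / of_nat n)"

lemma summable_dirichlet_L1:
  assumes k: "k > 0" "\<chi> \<in> dchars k" "\<chi> \<noteq> principal_dchar k"
  shows "summable (\<lambda>n. \<chi> n / of_nat n)"
  unfolding summable_Cauchy
proof (intro allI impI)
  fix e :: real assume e: "e > 0"
  obtain N where N: "4 * real k / e < real N" using reals_Archimedean2 by blast
  moreover have "4 * real k / e \<ge> 0" using e by simp
  ultimately have N0: "N > 0" by (intro Nat.gr0I) auto
  show "\<exists>N. \<forall>m\<ge>N. \<forall>n. norm (\<Sum>i\<in>{m..<n}. \<chi> i / of_nat i) < e"
  proof (intro exI[of _ N] allI impI)
    fix m n assume m: "m \<ge> N"
    have "4 * real k / real m \<le> 4 * real k / real N" using m N0 by (intro divide_left_mono) auto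
    also have "\<dots> < e" using N N0 e by (simp add: field_simps)
    finally have *: "4 * real k / real m < e" .
    show "norm (\<Sum>i\<in>{m..<n}. \<chi> i / of_nat i) < e"
    proof (cases n)
      case (Suc n')
      have "{m..<n} = {m..n'}" using Suc by auto
      thus ?thesis using norm_sum_dchar_over_le[OF k, of m n'] m N0 * by simp
    qed (use e in simp)
  qed
qed

lemma dirichlet_L1_tail:
  assumes k: "k > 0" "\<chi> \<in> dchars k" "\<chi> \<noteq> principal_dchar k"
  shows "norm (dirichlet_L1 \<chi> - (\<Sum>n=1..N. \<chi> n / of_nat n)) \<le> 4 * real k / real (Suc N)"
proof -
  have "(\<lambda>n. \<Sum>i<n. \<chi> i / of_nat i) \<longlonglongrightarrow> dirichlet_L1 \<chi>"
    unfolding dirichlet_L1_def by (rule summable_LIMSEQ[OF summable_dirichlet_L1[OF k]])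
  hence "(\<lambda>n. \<Sum>i<Suc n. \<chi> i / of_nat i) \<longlonglongrightarrow> dirichlet_L1 \<chi>" by (rule LIMSEQ_Suc)
  moreover have "(\<Sum>i<Suc n. \<chi> i / of_nat i) = (\<Sum>i=1..n. \<chi> i / of_nat i)" for n
    by (rule sum.mono_neutral_right) (auto simp: not_less_eq_eq)
  ultimately have "(\<lambda>n. \<Sum>i=1..n. \<chi> i / of_nat i) \<longlonglongrightarrow> dirichlet_L1 \<chi>" by simp
  hence "(\<lambda>n. (\<Sum>i=1..n. \<chi> i / of_nat i) - (\<Sum>i=1..N. \<chi> i / of_nat i))
      \<longlonglongrightarrow> dirichlet_L1 \<chi> - (\<Sum>i=1..N. \<chi> i / of_nat i)"
    by (intro tendsto_intros)
  moreover have "eventually (\<lambda>n. norm ((\<Sum>i=1..n. \<chi> i / of_nat i) - (\<Sum>i=1..N. \<chi> i / of_nat i))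
      \<le> 4 * real k / real (Suc N)) sequentially"
    using eventually_ge_at_top[of N]
  proof eventually_elim
    case (elim n)
    have "{1..n} = {1..N} \<union> {Suc N..n}" using elim by auto
    hence "(\<Sum>i=1..n. \<chi> i / of_nat i) = (\<Sum>i=1..N. \<chi> i / of_nat i) + (\<Sum>i=Suc N..n. \<chi> i / of_nat i)"
      by (simp only:) (rule sum.union_disjoint, auto)
    thus ?case using norm_sum_dchar_over_le[OF k, of "Suc N" n] by simp
  qed
  ultimately show ?thesis by (intro tendsto_upperbound[OF tendsto_norm]) auto
qed

text \<open>The tail bound in the form needed after regrouping by divisors: the factor
  \<open>d\<close> cancels the \<open>1 / d\<close> in the coefficient at \<open>d\<close>.\<close>

lemma dirichlet_L1_tail_div:
  assumes k: "k > 0" "\<chi> \<in> dchars k" "\<chi> \<noteq> principal_dchar k" and d: "d \<ge> 1" "N \<ge> 1"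
  shows "norm (dirichlet_L1 \<chi> - (\<Sum>n=1..N div d. \<chi> n / of_nat n)) \<le> 4 * real k * (real d / real N)"
proof -
  have "N < Suc (N div d) * d" using d by (simp add: dividend_less_div_times add.commute)
  hence "real N \<le> real (Suc (N div d)) * real d" by (metis of_nat_le_iff of_nat_mult less_imp_le)
  hence "1 / real (Suc (N div d)) \<le> real d / real N"
    using d by (simp add: field_simps)
  from mult_left_mono[OF this, of "4 * real k"]
  have "4 * real k / real (Suc (N div d)) \<le> 4 * real k * (real d / real N)" by simp
  thus ?thesis using dirichlet_L1_tail[OF k, of "N div d"] by linarith
qed

definition mangoldt_dchar_sum :: "(nat \<Rightarrow> complex) \<Rightarrow> nat \<Rightarrow> complex" where
  "mangoldt_dchar_sum \<chi> N = (\<Sum>n=1..N. \<chi> n * of_real (mangoldt n / real n))"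

text \<open>The function \<open>ln x / x\<close> decreases only from \<open>exp 1\<close> on, hence
  the start at 3.\<close>

lemma ln_over_antimono:
  assumes "n \<ge> 3"
  shows "ln (real (Suc n)) / real (Suc n) \<le> ln (real n) / real n"
proof -
  have "exp 1 \<le> real n" using exp_le assms by linarith
  hence 1: "1 \<le> ln (real n)" using assms by (subst ln_ge_iff) auto
  have "ln (real (Suc n)) - ln (real n) = ln (1 + 1 / real n)"
    using ln_div[of "real (Suc n)" "real n"] assms by (simp add: add_divide_distrib add.commute)
  also have "\<dots> \<le> 1 / real n" by (rule ln_add_one_self_le_self) simp
  finally have "real n * (ln (real (Suc n)) - ln (real n)) \<le> 1"
    using assms by (simp add: field_simps)
  hence "real n * ln (real (Suc n)) \<le> real (Suc n) * ln (real n)"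
    using 1 by (simp add: algebra_simps)
  thus ?thesis using assms by (simp add: divide_simps mult.commute)
qed

text \<open>Up to sign these are the partial sums of \<open>L'(1, \<chi>)\<close>. Partial summation
  covers \<open>n \<ge> 3\<close>; the term at 1 is 0 and the term at 2 is at most 1 in
  norm.\<close>

lemma norm_sum_dchar_ln_le:
  assumes k: "k > 0" "\<chi> \<in> dchars k" "\<chi> \<noteq> principal_dchar k"
  shows "norm (\<Sum>n=1..N. \<chi> n * of_real (ln (real n) / real n)) \<le> 1 + 4 * real k * ln 3"
proof -
  let ?f = "\<lambda>n. of_real (ln (real n) / real n) * \<chi> n"
  have "norm (\<Sum>n=3..N. ?f n) \<le> 4 * real k * (ln (real 3) / real 3)"
    by (intro norm_sum_antimono_le norm_sum_dchar_le k ln_over_antimono) auto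
  also have "\<dots> \<le> 4 * real k * ln 3"
    by (intro mult_left_mono) auto
  finally have 1: "norm (\<Sum>n=3..N. ?f n) \<le> 4 * real k * ln 3" .
  have 2: "norm (?f 2) \<le> 1"
  proof -
    have "norm (?f 2) \<le> (ln 2 / 2) * 1"
      unfolding norm_mult by (intro mult_mono norm_dchars_le[OF k(2,1)]) auto
    thus ?thesis using ln_2_less_1 by simp
  qed
  have "norm (\<Sum>n=1..N. ?f n) \<le> 1 + 4 * real k * ln 3"
  proof (cases "N \<ge> 2")
    case True
    hence "{1..N} = {1, 2} \<union> {3..N}" by auto
    hence "(\<Sum>n=1..N. ?f n) = (\<Sum>n\<in>{1, 2}. ?f n) + (\<Sum>n=3..N. ?f n)"
      by (simp only:) (rule sum.union_disjoint, auto)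
    also have "(\<Sum>n\<in>{1, 2}. ?f n) = ?f 2" by simp
    finally show ?thesis using norm_triangle_ineq[of "?f 2" "\<Sum>n=3..N. ?f n"] 1 2 by simp
  next
    case False
    hence "N = 0 \<or> N = 1" by auto
    thus ?thesis by auto
  qed
  thus ?thesis by (simp only: mult.commute)
qed

text \<open>Since \<open>ln\<close> is the divisor sum of \<open>\<Lambda>\<close> and
  \<open>\<chi>\<close> is multiplicative, the bounded sum of \<open>\<chi>(n) ln n / n\<close>
  regroups as the sum of \<open>a d * S (N div d)\<close>. Replacing \<open>S\<close> by its limit
  \<open>L(1, \<chi>)\<close> costs \<open>O(1)\<close> by Chebyshev's bound, and one divides by
  \<open>L(1, \<chi>)\<close>.\<close>

lemma mangoldt_dchar_sum_bounded:
  assumes k: "k > 0" "\<chi> \<in> dchars k" "\<chi> \<noteq> principal_dchar k" and L: "dirichlet_L1 \<chi> \<noteq> 0"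
  shows "\<exists>C. \<forall>N\<ge>1. norm (mangoldt_dchar_sum \<chi> N) \<le> C"
proof (intro exI allI impI)
  fix N :: nat assume N: "N \<ge> 1"
  define a where "a = (\<lambda>d. \<chi> d * of_real (mangoldt d / real d))"
  define S where "S = (\<lambda>M. \<Sum>m=1..M. \<chi> m / of_nat m)"
  have "(\<Sum>n=1..N. \<chi> n * of_real (ln (real n) / real n)) =
        (\<Sum>n=1..N. \<Sum>d | d dvd n. a d * (\<chi> (n div d) / of_nat (n div d)))"
  proof (rule sum.cong[OF refl])
    fix n assume n: "n \<in> {1..N}"
    have "\<chi> n * of_real (ln (real n) / real n) = (\<Sum>d | d dvd n. \<chi> n * of_real (mangoldt d / real n))"
      using n mangoldt_sum[of n, where ?'a = real]
      by (simp only: sum_distrib_left[symmetric] of_real_sum[symmetric] sum_divide_distrib[symmetric]) simp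
    also have "\<dots> = (\<Sum>d | d dvd n. a d * (\<chi> (n div d) / of_nat (n div d)))"
    proof (rule sum.cong[OF refl])
      fix d assume "d \<in> {d. d dvd n}"
      then obtain e where e: "n = d * e" by (auto elim: dvdE)
      thus "\<chi> n * of_real (mangoldt d / real n) = a d * (\<chi> (n div d) / of_nat (n div d))"
        using n by (simp add: a_def dcharsD(2)[OF k(2)])
    qed
    finally show "\<chi> n * of_real (ln (real n) / real n) = \<dots>" .
  qed
  also have "\<dots> = (\<Sum>d=1..N. \<Sum>m=1..N div d. a d * (\<chi> m / of_nat m))"
    by (rule sum_divisors_hyperbola)
  also have "\<dots> = (\<Sum>d=1..N. a d * S (N div d))" by (simp add: S_def sum_distrib_left)
  finally have E: "(\<Sum>n=1..N. \<chi> n * of_real (ln (real n) / real n)) = (\<Sum>d=1..N. a d * S (N div d))" .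
  have "dirichlet_L1 \<chi> * mangoldt_dchar_sum \<chi> N = 
      (\<Sum>d=1..N. a d * (dirichlet_L1 \<chi> - S (N div d))) + (\<Sum>n=1..N. \<chi> n * of_real (ln (real n) / real n))"
    unfolding E mangoldt_dchar_sum_def sum_distrib_left sum.distrib[symmetric]
    by (intro sum.cong) (simp_all add: a_def right_diff_distrib mult_ac del: of_real_divide)
  also have "norm \<dots> \<le> (\<Sum>d=1..N. mangoldt d * (4 * real k / real N)) + (1 + 4 * real k * ln 3)"
  proof (intro order.trans[OF norm_triangle_ineq] add_mono norm_sum_dchar_ln_le k sum_norm_le)
    fix d assume d: "d \<in> {1..N}"
    have "norm (a d) \<le> 1 * (mangoldt d / real d)"
      unfolding a_def norm_mult using mangoldt_nonneg[of d]
      by (intro mult_mono norm_dchars_le[OF k(2,1)]) (auto simp: norm_divide)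
    hence "norm (a d * (dirichlet_L1 \<chi> - S (N div d))) \<le> (mangoldt d / real d) * (4 * real k * (real d / real N))"
      unfolding norm_mult S_def using d N mangoldt_nonneg[of d]
      by (intro mult_mono dirichlet_L1_tail_div k) auto
    also have "\<dots> = mangoldt d * (4 * real k / real N)" using d by simp
    finally show "norm (a d * (dirichlet_L1 \<chi> - S (N div d))) \<le> \<dots>" .
  qed
  also have "(\<Sum>d=1..N. mangoldt d * (4 * real k / real N)) = (\<Sum>d=1..N. mangoldt d) * (4 * real k / real N)"
    by (simp only: sum_distrib_right)
  also have "\<dots> \<le> (4 * real N) * (4 * real k / real N)"
    by (intro mult_right_mono chebyshev_upper_bound) auto
  also have "\<dots> = 16 * real k" using N by simp
  finally show "norm (mangoldt_dchar_sum \<chi> N) \<le> (16 * real k + (1 + 4 * real k * ln 3)) / norm (dirichlet_L1 \<chi>)"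
    using L by (simp add: norm_mult field_simps)
qed

text \<open>
  The correction \<open>ln N\<close> at \<open>n = 1\<close> makes the summand the divisor sum of \<open>\<mu>(d) ln (N / d)\<close>; after
  interchanging summations, the inner sums are tails of \<open>L(1, \<chi>) = 0\<close>.
\<close>

lemma mangoldt_dchar_sum_of_L1_eq_0:
  assumes k: "k > 0" "\<chi> \<in> dchars k" "\<chi> \<noteq> principal_dchar k" and L: "dirichlet_L1 \<chi> = 0"
    and N: "N \<ge> 1"
  shows "norm (mangoldt_dchar_sum \<chi> N + of_real (ln (real N))) \<le> 4 * real k"
proof -
  define a where "a = (\<lambda>d. \<chi> d * of_real (moebius_mu d * ln (real N / real d) / real d))"
  define S where "S = (\<lambda>M. \<Sum>m=1..M. \<chi> m / of_nat m)"
  have "mangoldt_dchar_sum \<chi> N + of_real (ln (real N)) =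
        (\<Sum>n=1..N. \<chi> n * of_real ((mangoldt n + (if n = 1 then ln N else 0)) / real n))"
  proof -
    have "(\<Sum>n=1..N. \<chi> n * of_real ((mangoldt n + (if n = 1 then ln N else 0)) / real n)) =
        (\<Sum>n=1..N. \<chi> n * of_real (mangoldt n / real n) + (if n = 1 then of_real (ln N) else 0))"
      by (intro sum.cong) (auto simp: dcharsD[OF k(2)])
    thus ?thesis using N by (simp add: mangoldt_dchar_sum_def sum.distrib)
  qed
  also have "\<dots> = (\<Sum>n=1..N. \<Sum>d | d dvd n. a d * (\<chi> (n div d) / of_nat (n div d)))"
  proof (rule sum.cong[OF refl])
    fix n assume n: "n \<in> {1..N}"
    have "\<chi> n * of_real ((mangoldt n + (if n = 1 then ln N else 0)) / real n) =
        \<chi> n * of_real ((\<Sum>d | d dvd n. moebius_mu d * ln (real N / real d)) / real n)"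
      using n N by (subst sum_moebius_mu_ln) auto
    also have "\<dots> = (\<Sum>d | d dvd n. \<chi> n * of_real (moebius_mu d * ln (real N / real d) / real n))"
      by (simp only: sum_distrib_left[symmetric] of_real_sum[symmetric] sum_divide_distrib[symmetric])
    also have "\<dots> = (\<Sum>d | d dvd n. a d * (\<chi> (n div d) / of_nat (n div d)))"
    proof (rule sum.cong[OF refl])
      fix d assume "d \<in> {d. d dvd n}"
      then obtain e where e: "n = d * e" by (auto elim: dvdE)
      thus "\<chi> n * of_real (moebius_mu d * ln (real N / real d) / real n) =
          a d * (\<chi> (n div d) / of_nat (n div d))"
        using n by (simp add: a_def dcharsD(2)[OF k(2)])
    qed
    finally show "\<chi> n * of_real ((mangoldt n + (if n = 1 then ln N else 0)) / real n) = \<dots>" .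
  qed
  also have "\<dots> = (\<Sum>d=1..N. \<Sum>m=1..N div d. a d * (\<chi> m / of_nat m))"
    by (rule sum_divisors_hyperbola)
  also have "\<dots> = (\<Sum>d=1..N. a d * S (N div d))" by (simp add: S_def sum_distrib_left)
  also have "norm \<dots> \<le> (\<Sum>d=1..N. ln (real N / real d) * (4 * real k / real N))"
  proof (rule sum_norm_le)
    fix d assume d: "d \<in> {1..N}"
    have ln0: "0 \<le> ln (real N / real d)" using d by simp
    have "norm (a d) \<le> 1 * (1 * (ln (real N / real d) / real d))"
      unfolding a_def norm_mult times_divide_eq_right[symmetric] norm_of_real abs_mult
      using ln0 by (intro mult_mono norm_dchars_le[OF k(2,1)] abs_moebius_mu_le) auto
    hence "norm (a d * S (N div d)) \<le> (ln (real N / real d) / real d) * (4 * real k * (real d / real N))"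
      unfolding norm_mult S_def using d N ln0 dirichlet_L1_tail_div[OF k, of d N] L
      by (intro mult_mono) auto
    also have "\<dots> = ln (real N / real d) * (4 * real k / real N)" using d by simp
    finally show "norm (a d * S (N div d)) \<le> \<dots>" .
  qed
  also have "\<dots> = (\<Sum>d=1..N. ln (real N / real d)) * (4 * real k / real N)"
    by (simp only: sum_distrib_right)
  also have "\<dots> \<le> real N * (4 * real k / real N)"
    by (intro mult_right_mono sum_ln_quotient_le) auto
  finally show ?thesis using N by simp
qed

text \<open>A form of Mertens' theorem. The sum of \<open>\<chi>(n) ln n\<close> is evaluated twice
  up to \<open>O(N)\<close>: directly as \<open>c * N * ln N\<close>, and by regrouping
  \<open>ln\<close> over divisors as \<open>c * N\<close> times the Mangoldt sum. Then one divides
  by \<open>c * N\<close>.\<close>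

lemma mangoldt_dchar_sum_principal:
  assumes k: "k > 0"
  shows "\<exists>C. \<forall>N\<ge>1. norm (mangoldt_dchar_sum (principal_dchar k) N - of_real (ln (real N))) \<le> C"
proof (intro exI allI impI)
  fix N :: nat assume N: "N \<ge> 1"
  define \<chi> where "\<chi> = principal_dchar k"
  have \<chi>: "\<chi> \<in> dchars k" unfolding \<chi>_def by (rule principal_dchar_in_dchars)
  define Q where "Q = (\<lambda>M. \<Sum>m=1..M. \<chi> m)"
  \<comment> \<open>The density of the integers coprime to \<open>k\<close>; it is nonzero since 1
    is among them.\<close>
  define c where "c = Q k / of_nat k"
  have Qc: "norm (Q M - of_nat M * c) \<le> 2 * real k" for M
    using norm_sum_dchar_minus_mean[OF k \<chi>, of M] by (simp add: Q_def c_def)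
  have c1: "norm c \<le> 1"
    using sum_norm_le[of "{1..k}" \<chi> "\<lambda>_. 1"] norm_dchars_le[OF \<chi> k] k
    by (simp add: c_def Q_def norm_divide)
  have c0: "c \<noteq> 0"
  proof -
    have "Re (\<chi> 1) \<le> (\<Sum>m=1..k. Re (\<chi> m))"
      using k by (intro member_le_sum) (auto simp: \<chi>_def principal_dchar_def)
    hence "Re (Q k) \<noteq> 0" by (simp add: Q_def \<chi>_def principal_dchar_def)
    thus ?thesis using k by (auto simp: c_def)
  qed
  have "(\<Sum>n=1..N. \<chi> n * of_real (ln (real n))) =
        (\<Sum>n=1..N. \<Sum>d | d dvd n. \<chi> d * of_real (mangoldt d) * \<chi> (n div d))"
  proof (rule sum.cong[OF refl])
    fix n assume n: "n \<in> {1..N}"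
    have "\<chi> n * of_real (ln (real n)) = (\<Sum>d | d dvd n. \<chi> n * of_real (mangoldt d))"
      using n mangoldt_sum[of n, where ?'a = real]
      by (simp only: sum_distrib_left[symmetric] of_real_sum[symmetric]) simp
    also have "\<dots> = (\<Sum>d | d dvd n. \<chi> d * of_real (mangoldt d) * \<chi> (n div d))"
    proof (rule sum.cong[OF refl])
      fix d assume "d \<in> {d. d dvd n}"
      then obtain e where e: "n = d * e" by (auto elim: dvdE)
      thus "\<chi> n * of_real (mangoldt d) = \<chi> d * of_real (mangoldt d) * \<chi> (n div d)"
        using n by (simp add: dcharsD(2)[OF \<chi>])
    qed
    finally show "\<chi> n * of_real (ln (real n)) = \<dots>" .
  qed
  also have "\<dots> = (\<Sum>d=1..N. \<Sum>m=1..N div d. \<chi> d * of_real (mangoldt d) * \<chi> m)"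
    by (rule sum_divisors_hyperbola)
  also have "\<dots> = (\<Sum>d=1..N. \<chi> d * of_real (mangoldt d) * Q (N div d))"
    by (simp only: Q_def sum_distrib_left)
  finally have E: "(\<Sum>n=1..N. \<chi> n * of_real (ln (real n))) = \<dots>" .
  have 1: "norm ((\<Sum>d=1..N. \<chi> d * of_real (mangoldt d) * Q (N div d)) -
        c * of_nat N * mangoldt_dchar_sum \<chi> N) \<le> (2 * real k + 1) * (4 * real N)"
  proof -
    have "(\<Sum>d=1..N. \<chi> d * of_real (mangoldt d) * Q (N div d)) - c * of_nat N * mangoldt_dchar_sum \<chi> N
      = (\<Sum>d=1..N. \<chi> d * of_real (mangoldt d) * (Q (N div d) - c * of_real (real N / real d)))"
      unfolding mangoldt_dchar_sum_def sum_distrib_left sum_subtractf[symmetric]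
      by (intro sum.cong) (auto simp: field_simps)
    also have "norm \<dots> \<le> (\<Sum>d=1..N. mangoldt d * (2 * real k + 1))"
    proof (rule sum_norm_le)
      fix d assume d: "d \<in> {1..N}"
      \<comment> \<open>Rounding \<open>N / d\<close> down changes it by at most 1, which adds the
        \<open>+ 1\<close> to the error \<open>2 * k\<close> of \<open>Q\<close>.\<close>
      have "real N = real d * real (N div d) + real (N mod d)"
        by (metis of_nat_add of_nat_mult mult_div_mod_eq)
      hence "real N / real d = real (N div d) + real (N mod d) / real d"
        using d by (simp add: field_simps)
      moreover have "real (N mod d) / real d \<le> 1" using d by (simp add: less_imp_le)
      ultimately have "\<bar>real (N div d) - real N / real d\<bar> \<le> 1" by simp
      hence 3: "norm (c * of_real (real (N div d) - real N / real d)) \<le> 1 * 1"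
        unfolding norm_mult norm_of_real using c1 by (intro mult_mono) auto
      have 4: "Q (N div d) - c * of_real (real N / real d) =
          (Q (N div d) - of_nat (N div d) * c) + c * of_real (real (N div d) - real N / real d)"
        by (simp add: algebra_simps)
      have "norm (Q (N div d) - c * of_real (real N / real d)) \<le> 2 * real k + 1"
        unfolding 4 by (rule norm_triangle_le) (use Qc[of "N div d"] 3 in linarith)
      moreover have "norm (\<chi> d * of_real (mangoldt d)) \<le> 1 * mangoldt d"
        unfolding norm_mult by (intro mult_mono norm_dchars_le[OF \<chi> k]) (auto intro: mangoldt_nonneg)
      ultimately show "norm (\<chi> d * of_real (mangoldt d) * (Q (N div d) - c * of_real (real N / real d)))
          \<le> mangoldt d * (2 * real k + 1)"
        unfolding norm_mult using mangoldt_nonneg by (intro mult_mono) auto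
    qed
    also have "\<dots> = (\<Sum>d=1..N. mangoldt d) * (2 * real k + 1)"
      by (simp only: sum_distrib_right)
    also have "\<dots> \<le> (4 * real N) * (2 * real k + 1)"
      by (intro mult_right_mono chebyshev_upper_bound) auto
    finally show ?thesis by (simp only: mult.commute)
  qed
  have 2: "norm ((\<Sum>n=1..N. \<chi> n * of_real (ln (real n))) - c * of_nat N * of_real (ln (real N)))
      \<le> 2 * real k * real N + real N"
  proof -
    \<comment> \<open>Writing \<open>ln n = ln N - ln (N / n)\<close> isolates the main term; the
      rest is at most the sum of \<open>ln (N / n)\<close>, hence at most \<open>N\<close>.\<close>
    have "(\<Sum>n=1..N. \<chi> n * of_real (ln (real n))) =
        (\<Sum>n=1..N. \<chi> n * of_real (ln (real N)) - \<chi> n * of_real (ln (real N / real n)))"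
      using N by (intro sum.cong) (auto simp: ln_div algebra_simps)
    also have "\<dots> = Q N * of_real (ln (real N)) - (\<Sum>n=1..N. \<chi> n * of_real (ln (real N / real n)))"
      by (simp only: Q_def sum_distrib_right sum_subtractf)
    finally have "(\<Sum>n=1..N. \<chi> n * of_real (ln (real n))) - c * of_nat N * of_real (ln (real N)) =
        (Q N - of_nat N * c) * of_real (ln (real N)) - (\<Sum>n=1..N. \<chi> n * of_real (ln (real N / real n)))"
      by (simp add: algebra_simps)
    also have "norm \<dots> \<le> 2 * real k * real N + (\<Sum>n=1..N. ln (real N / real n))"
    proof (intro order.trans[OF norm_triangle_ineq4] add_mono sum_norm_le)
      have "ln (real N) \<le> real N" using ln_le_minus_one[of "real N"] N by simp
      thus "norm ((Q N - of_nat N * c) * of_real (ln (real N))) \<le> 2 * real k * real N"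
        unfolding norm_mult using N by (intro mult_mono Qc) auto
      fix n assume n: "n \<in> {1..N}"
      hence "norm (\<chi> n * of_real (ln (real N / real n))) \<le> 1 * ln (real N / real n)"
        unfolding norm_mult by (intro mult_mono norm_dchars_le[OF \<chi> k]) auto
      thus "norm (\<chi> n * of_real (ln (real N / real n))) \<le> ln (real N / real n)" by simp
    qed
    also have "\<dots> \<le> 2 * real k * real N + real N" using sum_ln_quotient_le[of N] by simp
    finally show ?thesis .
  qed
  have "norm (c * of_nat N * (mangoldt_dchar_sum \<chi> N - of_real (ln (real N)))) \<le> 
     (2 * real k + 1) * (4 * real N) + (2 * real k * real N + real N)"
  proof -
    have "c * of_nat N * (mangoldt_dchar_sum \<chi> N - of_real (ln (real N))) =
      ((\<Sum>n=1..N. \<chi> n * of_real (ln (real n))) - c * of_nat N * of_real (ln (real N))) -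
      ((\<Sum>d=1..N. \<chi> d * of_real (mangoldt d) * Q (N div d)) - c * of_nat N * mangoldt_dchar_sum \<chi> N)"
      unfolding E by (simp add: algebra_simps)
    thus ?thesis using add_mono[OF 2 1] norm_triangle_ineq4
      by (simp only:) (rule order.trans[OF norm_triangle_ineq4], simp only: add.commute)
  qed
  also have "\<dots> = real N * (5 * (2 * real k + 1))" by (simp add: algebra_simps)
  finally have "norm c * norm (mangoldt_dchar_sum \<chi> N - of_real (ln (real N))) \<le> 5 * (2 * real k + 1)"
    using N by (simp add: norm_mult mult.assoc mult.left_commute[of _ "real N"] mult_le_cancel_left_pos)
  thus "norm (mangoldt_dchar_sum (principal_dchar k) N - of_real (ln (real N))) \<le> 5 * (2 * real k + 1) / norm c"
    using c0 by (simp add: \<chi>_def field_simps)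
qed

section \<open>At most one vanishing L-value\<close>

text \<open>The residue class is given by an inverse \<open>b\<close>, so that
  \<open>\<chi> b * \<chi> n = \<chi> (b * n)\<close> and orthogonality at 1 applies without
  conjugates.\<close>

lemma mangoldt_progression_sum:
  assumes k: "k > 0" and b: "coprime b k"
  shows "of_nat (card (dchars k)) * of_real (\<Sum>n | n \<in> {1..N} \<and> [b * n = 1] (mod k). mangoldt n / real n) =
    (\<Sum>\<chi>\<in>dchars k. \<chi> b * mangoldt_dchar_sum \<chi> N)"
proof -
  have "(\<Sum>\<chi>\<in>dchars k. \<chi> b * mangoldt_dchar_sum \<chi> N) =
      (\<Sum>\<chi>\<in>dchars k. \<Sum>n=1..N. \<chi> (b * n) * of_real (mangoldt n / real n))"
    unfolding mangoldt_dchar_sum_def sum_distrib_left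
    by (intro sum.cong refl) (simp add: dcharsD)
  also have "\<dots> = (\<Sum>n=1..N. (\<Sum>\<chi>\<in>dchars k. \<chi> (b * n)) * of_real (mangoldt n / real n))"
    by (subst sum.swap) (simp only: sum_distrib_right)
  also have "\<dots> = (\<Sum>n=1..N. if [b * n = 1] (mod k)
      then of_nat (card (dchars k)) * of_real (mangoldt n / real n) else 0)"
  proof (rule sum.cong[OF refl])
    fix n
    show "(\<Sum>\<chi>\<in>dchars k. \<chi> (b * n)) * of_real (mangoldt n / real n) =
        (if [b * n = 1] (mod k) then of_nat (card (dchars k)) * of_real (mangoldt n / real n) else 0)"
    proof (cases "coprime n k")
      case True
      thus ?thesis using sum_dchars[OF k, of "b * n"] b by simp
    next
      case False
      hence nc: "\<not> coprime (b * n) k" by simp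
      hence "\<not> [b * n = 1] (mod k)" using cong_imp_coprime[OF cong_sym, of "b * n" 1 k] by auto
      moreover have "(\<Sum>\<chi>\<in>dchars k. \<chi> (b * n)) = 0"
        using nc dcharsD(4) by (intro sum.neutral) blast
      ultimately show ?thesis by simp
    qed
  qed
  also have "\<dots> = (\<Sum>n | n \<in> {1..N} \<and> [b * n = 1] (mod k).
      of_nat (card (dchars k)) * of_real (mangoldt n / real n))"
    by (subst sum.inter_filter[symmetric]) auto
  finally show ?thesis by (simp add: sum_distrib_left)
qed

lemma dirichlet_L1_cnj:
  "dirichlet_L1 (\<lambda>n. cnj (\<chi> n)) = cnj (dirichlet_L1 \<chi>)"
  if "summable (\<lambda>n. \<chi> n / of_nat n)"
proof -
  have "(\<lambda>n. cnj (\<chi> n / of_nat n)) sums cnj (\<Sum>n. \<chi> n / of_nat n)"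
    using summable_sums[OF that] by (simp only: sums_cnj)
  thus ?thesis unfolding dirichlet_L1_def by (simp add: sums_unique[symmetric])
qed

text \<open>The principal character is set apart because its series diverges, so that
  \<open>dirichlet_L1\<close> is an unspecified value there.\<close>

definition vanishing_dchars :: "nat \<Rightarrow> (nat \<Rightarrow> complex) set" where
  "vanishing_dchars k = {\<chi> \<in> dchars k. \<chi> \<noteq> principal_dchar k \<and> dirichlet_L1 \<chi> = 0}"

lemma mangoldt_dchar_sum_asymptotics:
  assumes k: "k > 0" and \<chi>: "\<chi> \<in> dchars k"
  defines "e \<equiv> (if \<chi> = principal_dchar k then 1 else if \<chi> \<in> vanishing_dchars k then -1 else 0) :: real"
  shows "\<exists>C. \<forall>N\<ge>1. norm (mangoldt_dchar_sum \<chi> N - of_real (e * ln (real N))) \<le> C"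
proof (cases "\<chi> = principal_dchar k")
  case True
  thus ?thesis using mangoldt_dchar_sum_principal[OF k] by (simp add: e_def)
next
  case nonprincipal: False
  show ?thesis
  proof (cases "dirichlet_L1 \<chi> = 0")
    case True
    hence "e = -1" using nonprincipal \<chi> by (simp add: e_def vanishing_dchars_def)
    thus ?thesis using mangoldt_dchar_sum_of_L1_eq_0[OF k \<chi> nonprincipal True] by auto
  next
    case False
    hence "e = 0" using nonprincipal by (simp add: e_def vanishing_dchars_def)
    thus ?thesis using mangoldt_dchar_sum_bounded[OF k \<chi> nonprincipal False] by simp
  qed
qed

text \<open>Serves twice: at \<open>b = 1\<close> the coefficient of \<open>ln N\<close> counts the
  vanishing characters, and once there are none it is 1 for every \<open>b\<close>.\<close>

lemma mangoldt_progression_asymptotics: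
  assumes k: "k > 0" and b: "coprime b k"
  shows "\<exists>C. \<forall>N\<ge>1. norm (of_nat (card (dchars k)) *
      of_real (\<Sum>n | n \<in> {1..N} \<and> [b * n = 1] (mod k). mangoldt n / real n) -
      (1 - (\<Sum>\<chi>\<in>vanishing_dchars k. \<chi> b)) * of_real (ln (real N))) \<le> C"
proof -
  define e where "e = (\<lambda>\<chi>. (if \<chi> = principal_dchar k then 1 else if \<chi> \<in> vanishing_dchars k then -1 else 0) :: real)"
  have "\<forall>\<chi>\<in>dchars k. \<exists>C. \<forall>N\<ge>1. norm (mangoldt_dchar_sum \<chi> N - of_real (e \<chi> * ln (real N))) \<le> C"
    unfolding e_def using mangoldt_dchar_sum_asymptotics[OF k] by blast
  then obtain C where C: "\<And>\<chi> N. \<chi> \<in> dchars k \<Longrightarrow> N \<ge> 1 \<Longrightarrow>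
      norm (mangoldt_dchar_sum \<chi> N - of_real (e \<chi> * ln (real N))) \<le> C \<chi>"
    by metis
  have fin: "finite (dchars k)" by (rule finite_dchars[OF k])
  have V: "vanishing_dchars k \<subseteq> dchars k" "principal_dchar k \<notin> vanishing_dchars k"
    by (auto simp: vanishing_dchars_def)
  have "(\<Sum>\<chi>\<in>dchars k. \<chi> b * of_real (e \<chi>)) =
      (\<Sum>\<chi>\<in>insert (principal_dchar k) (vanishing_dchars k). \<chi> b * of_real (e \<chi>))"
    using fin V principal_dchar_in_dchars by (intro sum.mono_neutral_right) (auto simp: e_def)
  also have "\<dots> = 1 + (\<Sum>\<chi>\<in>vanishing_dchars k. \<chi> b * of_real (e \<chi>))"
    using V fin b finite_subset[OF V(1)] by (simp add: principal_dchar_def e_def)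
  also have "(\<Sum>\<chi>\<in>vanishing_dchars k. \<chi> b * of_real (e \<chi>)) = (\<Sum>\<chi>\<in>vanishing_dchars k. - \<chi> b)"
    using V by (intro sum.cong) (auto simp: e_def)
  finally have E: "1 - (\<Sum>\<chi>\<in>vanishing_dchars k. \<chi> b) = (\<Sum>\<chi>\<in>dchars k. \<chi> b * of_real (e \<chi>))"
    by (simp add: sum_negf)
  show ?thesis
  proof (intro exI allI impI)
    fix N :: nat assume N: "N \<ge> 1"
    have "of_nat (card (dchars k)) *
      of_real (\<Sum>n | n \<in> {1..N} \<and> [b * n = 1] (mod k). mangoldt n / real n) -
      (1 - (\<Sum>\<chi>\<in>vanishing_dchars k. \<chi> b)) * of_real (ln (real N)) =
      (\<Sum>\<chi>\<in>dchars k. \<chi> b * (mangoldt_dchar_sum \<chi> N - of_real (e \<chi> * ln (real N))))"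
      unfolding E mangoldt_progression_sum[OF k b] sum_distrib_right sum_subtractf[symmetric]
      by (intro sum.cong) (auto simp: algebra_simps)
    also have "norm \<dots> \<le> (\<Sum>\<chi>\<in>dchars k. 1 * C \<chi>)"
      unfolding norm_mult
      by (intro sum_norm_le) (auto simp only: norm_mult intro!: mult_mono norm_dchars_le k C N norm_ge_zero zero_le_one)
    finally show "norm (of_nat (card (dchars k)) *
      of_real (\<Sum>n | n \<in> {1..N} \<and> [b * n = 1] (mod k). mangoldt n / real n) -
      (1 - (\<Sum>\<chi>\<in>vanishing_dchars k. \<chi> b)) * of_real (ln (real N))) \<le> \<dots>" .
  qed
qed

lemma ln_nat_unbounded: "\<exists>N\<ge>1. C < ln (real N)"
proof -
  obtain N where "exp C < real N" using reals_Archimedean2 by blast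
  moreover from this have "N \<ge> 1" using exp_gt_zero[of C] by (cases N) (auto simp: not_less)
  ultimately show ?thesis by (metis exp_less_cancel_iff exp_ln of_nat_0_less_iff less_le_trans zero_less_one)
qed

text \<open>With two or more vanishing characters the coefficient of \<open>ln N\<close> would be at
  most -1, although the sum over \<open>n \<equiv> 1\<close> is nonnegative.\<close>

lemma card_vanishing_dchars_le:
  assumes k: "k > 0"
  shows "card (vanishing_dchars k) \<le> 1"
proof (rule ccontr)
  assume *: "\<not> card (vanishing_dchars k) \<le> 1"
  define V where "V = real (card (vanishing_dchars k))"
  define S where "S = (\<lambda>N. \<Sum>n | n \<in> {1..N} \<and> [1 * n = 1] (mod k). mangoldt n / real n)"
  have "(\<Sum>\<chi>\<in>vanishing_dchars k. \<chi> 1) = (\<Sum>\<chi>\<in>vanishing_dchars k. 1)"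
    by (intro sum.cong) (auto simp: vanishing_dchars_def dcharsD)
  hence V: "(\<Sum>\<chi>\<in>vanishing_dchars k. \<chi> 1) = of_real V" by (simp add: V_def)
  have "coprime 1 k" by simp
  from mangoldt_progression_asymptotics[OF k this]
  obtain C where C: "\<And>N. N \<ge> 1 \<Longrightarrow> norm (of_nat (card (dchars k)) * of_real (S N) -
      (1 - of_real V) * complex_of_real (ln (real N))) \<le> C"
    unfolding V S_def by blast
  obtain N where N: "N \<ge> 1" "C < ln (real N)" using ln_nat_unbounded by blast
  have "of_nat (card (dchars k)) * of_real (S N) - (1 - of_real V) * of_real (ln (real N)) =
      complex_of_real (real (card (dchars k)) * S N - (1 - V) * ln (real N))" by simp
  hence "\<bar>real (card (dchars k)) * S N - (1 - V) * ln (real N)\<bar> \<le> C"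
    using C[OF N(1)] by (simp only: norm_of_real)
  moreover have "S N \<ge> 0"
    unfolding S_def by (intro sum_nonneg divide_nonneg_nonneg mangoldt_nonneg) auto
  hence "real (card (dchars k)) * S N \<ge> 0" by simp
  moreover have "1 * ln (real N) \<le> (V - 1) * ln (real N)"
    using * N(1) by (intro mult_right_mono) (auto simp: V_def)
  moreover have "(1 - V) * ln (real N) = - ((V - 1) * ln (real N))" by (simp add: algebra_simps)
  ultimately show False using N(2) by linarith
qed

lemma vanishing_dchars_real:
  assumes k: "k > 0" and \<chi>: "\<chi> \<in> vanishing_dchars k"
  shows "cnj (\<chi> n) = \<chi> n"
proof -
  have \<chi>': "\<chi> \<in> dchars k" "\<chi> \<noteq> principal_dchar k" "dirichlet_L1 \<chi> = 0"
    using \<chi> by (auto simp: vanishing_dchars_def)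
  let ?\<psi> = "\<lambda>n. cnj (\<chi> n)"
  have "?\<psi> \<noteq> principal_dchar k"
  proof
    assume *: "?\<psi> = principal_dchar k"
    have "\<chi> m = principal_dchar k m" for m
      using arg_cong[OF fun_cong[OF *, of m], of cnj] by (simp add: principal_dchar_def split: if_splits)
    thus False using \<chi>'(2) by blast
  qed
  hence "?\<psi> \<in> vanishing_dchars k"
    using \<chi>' dchars_cnj[OF \<chi>'(1)] dirichlet_L1_cnj[OF summable_dirichlet_L1[OF k \<chi>'(1,2)]]
    by (simp add: vanishing_dchars_def)
  moreover have "finite (vanishing_dchars k)"
    using finite_dchars[OF k] by (simp add: vanishing_dchars_def)
  ultimately have "?\<psi> = \<chi>"
    using card_vanishing_dchars_le[OF k] \<chi> card_le_Suc0_iff_eq[of "vanishing_dchars k"] by auto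
  from fun_cong[OF this, of n] show ?thesis by simp
qed

section \<open>Non-vanishing for real characters\<close>

lemma sum_divisors_coprime_mult:
  fixes f :: "nat \<Rightarrow> 'a :: comm_semiring_1"
  assumes f: "\<And>m n. f (m * n) = f m * f n" and ab: "coprime a b" "a > 0" "b > 0"
  shows "(\<Sum>d | d dvd a * b. f d) = (\<Sum>d | d dvd a. f d) * (\<Sum>d | d dvd b. f d)"
proof -
  have "bij_betw (\<lambda>(d, e). d * e) ({d. d dvd a} \<times> {e. e dvd b}) {d. d dvd a * b}"
    unfolding bij_betw_def
  proof
    show "inj_on (\<lambda>(d, e). d * e) ({d. d dvd a} \<times> {e. e dvd b})"
    proof (rule inj_onI, clarify)
      fix d e d' e' assume *: "d dvd a" "e dvd b" "d' dvd a" "e' dvd b" "d * e = d' * e'"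
      have cop: "coprime x y" if "x dvd a" "y dvd b" for x y
        using that ab(1) by (metis coprime_divisors)
      have "d dvd d'" using * cop[of d e'] by (metis coprime_dvd_mult_left_iff dvd_triv_left)
      moreover have "d' dvd d" using * cop[of d' e] by (metis coprime_dvd_mult_left_iff dvd_triv_left)
      ultimately have "d = d'" by (rule dvd_antisym)
      moreover have "d > 0" using *(1) ab(2) by (rule dvd_pos_nat[rotated])
      ultimately show "d = d' \<and> e = e'" using *(5) by simp
    qed
    show "(\<lambda>(d, e). d * e) ` ({d. d dvd a} \<times> {e. e dvd b}) = {d. d dvd a * b}"
      using division_decomp[of _ a b] by (force intro: mult_dvd_mono)
  qed
  from sum.reindex_bij_betw[OF this, of f]
  have "(\<Sum>d | d dvd a * b. f d) = (\<Sum>(d, e)\<in>{d. d dvd a} \<times> {e. e dvd b}. f d * f e)"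
    by (simp add: case_prod_unfold f)
  also have "\<dots> = (\<Sum>d | d dvd a. f d) * (\<Sum>d | d dvd b. f d)"
    by (simp add: sum_product sum.cartesian_product)
  finally show ?thesis .
qed

lemma sum_divisors_prime_power:
  fixes f :: "nat \<Rightarrow> 'a :: comm_semiring_1"
  assumes "f 1 = 1" "\<And>m n. f (m * n) = f m * f n" and p: "prime p"
  shows "(\<Sum>d | d dvd p ^ e. f d) = (\<Sum>i\<le>e. f p ^ i)"
proof -
  have pw: "f (p ^ i) = f p ^ i" for i by (induction i) (use assms in auto)
  have "{d. d dvd p ^ e} = (\<lambda>i. p ^ i) ` {..e}" using p by (auto simp: divides_primepow_nat)
  moreover have "inj_on (\<lambda>i. p ^ i) {..e}"
    using prime_gt_1_nat[OF p] by (auto simp: inj_on_def)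
  ultimately show ?thesis by (simp add: sum.reindex pw)
qed

lemma nat_prime_power_coprime_induct [case_names one step]:
  assumes "P (1::nat)"
    and "\<And>p e m. prime p \<Longrightarrow> coprime (p ^ e) m \<Longrightarrow> m > 0 \<Longrightarrow> P m \<Longrightarrow> P (p ^ e * m)"
    and "n > 0"
  shows "P n"
  using \<open>n > 0\<close>
proof (induction n rule: less_induct)
  case (less n)
  show ?case
  proof (cases "n = 1")
    case False
    then obtain p where p: "prime p" "p dvd n" using prime_factor_nat by blast
    obtain m where m: "n = p ^ multiplicity p n * m" "\<not> p dvd m"
      using multiplicity_decompose'[of n p] less.prems prime_gt_1_nat[OF p(1)] by auto
    have "multiplicity p n > 0"
      using p less.prems by (simp add: prime_multiplicity_gt_zero_iff)
    hence "p ^ multiplicity p n > 1" using prime_gt_1_nat[OF p(1)] by (intro one_less_power)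
    moreover have m0: "m > 0" using m(1) less.prems by (intro Nat.gr0I) simp
    ultimately have "m < n" using m(1) n_less_m_mult_n[of m "p ^ multiplicity p n"] by simp
    moreover have "coprime (p ^ multiplicity p n) m"
      using p(1) m(2) by (simp add: prime_imp_coprime)
    ultimately show ?thesis using assms(2)[OF p(1) _ m0 less.IH] m(1) m0 by metis
  qed (use assms in simp)
qed

text \<open>For ratio -1 the sum alternates between 1 and 0, and an even top exponent yields 1; for
  ratio 0 only \<open>0 ^ 0 = 1\<close> remains.\<close>

lemma sum_powers_sign:
  fixes x :: real
  assumes "x \<in> {-1, 0, 1}"
  shows "0 \<le> (\<Sum>i\<le>e. x ^ i)" "1 \<le> (\<Sum>i\<le>2 * e. x ^ i)"
proof -
  have "(\<Sum>i\<le>e. (-1::real) ^ i) = (if even e then 1 else 0)" for e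
    by (induction e) auto
  moreover have "(\<Sum>i\<le>e. (0::real) ^ i) = 1" for e
    by (induction e) auto
  ultimately show "0 \<le> (\<Sum>i\<le>e. x ^ i)" "1 \<le> (\<Sum>i\<le>2 * e. x ^ i)"
    using assms by auto
qed

section \<open>Divisor sums of a real character\<close>

locale real_dchar =
  fixes k :: nat and \<chi> :: "nat \<Rightarrow> complex"
  assumes k: "k > 0" and dchar: "\<chi> \<in> dchars k" and real: "cnj (\<chi> n) = \<chi> n"
begin

definition r :: "nat \<Rightarrow> real" where "r n = Re (\<chi> n)"

lemma dchar_eq_r: "\<chi> n = of_real (r n)"
  using real[of n] by (simp add: r_def complex_eq_iff)

lemma r_mult: "r (m * n) = r m * r n"
  using dcharsD(2)[OF dchar, of m n] by (simp add: r_def real complex_eq_iff) (simp add: dchar_eq_r)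

lemma r_1: "r 1 = 1"
  by (simp add: r_def dcharsD[OF dchar])

lemma r_values: "r n \<in> {-1, 0, 1}"
proof (cases "coprime n k")
  case True
  hence "\<bar>r n\<bar> = 1" using norm_dchars[OF dchar k True] by (simp add: dchar_eq_r)
  thus ?thesis by auto
next
  case False
  thus ?thesis using dcharsD(4)[OF dchar, of n] by (simp add: r_def)
qed

text \<open>The divisor sum of \<open>r\<close> is multiplicative, and on prime powers it is a
  geometric sum with ratio -1, 0 or 1. In a square every exponent is even.\<close>

lemma sum_divisors_r:
  assumes "n > 0"
  shows "0 \<le> (\<Sum>d | d dvd n. r d)" "1 \<le> (\<Sum>d | d dvd n\<^sup>2. r d)"
proof -
  have "0 \<le> (\<Sum>d | d dvd n. r d) \<and> 1 \<le> (\<Sum>d | d dvd n\<^sup>2. r d)"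
  proof (induction n rule: nat_prime_power_coprime_induct)
    case one
    thus ?case using r_1 by simp
  next
    case (step p e m)
    have p0: "p ^ e > 0" using prime_gt_0_nat[OF step(1)] by simp
    have pp: "(\<Sum>d | d dvd p ^ i. r d) = (\<Sum>j\<le>i. r p ^ j)" for i
      by (rule sum_divisors_prime_power[OF r_1 r_mult step(1)])
    have "(\<Sum>d | d dvd p ^ e * m. r d) = (\<Sum>j\<le>e. r p ^ j) * (\<Sum>d | d dvd m. r d)"
      unfolding pp[symmetric] by (rule sum_divisors_coprime_mult[OF r_mult step(2) p0 step(3)])
    hence 1: "0 \<le> (\<Sum>d | d dvd p ^ e * m. r d)"
      using sum_powers_sign(1)[OF r_values, of p e] step(3,4) by simp
    have "(p ^ e * m)\<^sup>2 = p ^ (2 * e) * m\<^sup>2" by (simp add: power_mult_distrib power_mult[symmetric] mult.commute)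
    moreover have "coprime (p ^ (2 * e)) (m\<^sup>2)" using step(2) by (cases "e = 0") auto
    hence "(\<Sum>d | d dvd p ^ (2 * e) * m\<^sup>2. r d) = (\<Sum>j\<le>2 * e. r p ^ j) * (\<Sum>d | d dvd m\<^sup>2. r d)"
      unfolding pp[symmetric] using prime_gt_0_nat[OF step(1)] step(3)
      by (intro sum_divisors_coprime_mult[OF r_mult]) auto
    moreover have "1 * 1 \<le> (\<Sum>j\<le>2 * e. r p ^ j) * (\<Sum>d | d dvd m\<^sup>2. r d)"
      using sum_powers_sign(2)[OF r_values, of p e] step(3,4) by (intro mult_mono) auto
    ultimately show ?case using 1 by simp
  qed (rule assms)
  thus "0 \<le> (\<Sum>d | d dvd n. r d)" "1 \<le> (\<Sum>d | d dvd n\<^sup>2. r d)" by auto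
qed

end

text \<open>Cauchy-Schwarz with \<open>t ^ i\<close> paired against \<open>t ^ (n - 1 - i)\<close>,
  whose product does not depend on \<open>i\<close>.\<close>

lemma geometric_sum_square_ge:
  fixes t :: real
  assumes t: "0 < t" and n: "n > 0"
  shows "(real n)\<^sup>2 * t ^ (n - 1) \<le> (\<Sum>i<n. t ^ i)\<^sup>2"
proof -
  have "(\<Sum>i<n. sqrt (t ^ i) * sqrt (t ^ (n - 1 - i)))\<^sup>2 \<le>
      (\<Sum>i<n. (sqrt (t ^ i))\<^sup>2) * (\<Sum>i<n. (sqrt (t ^ (n - 1 - i)))\<^sup>2)"
    by (rule Cauchy_Schwarz_ineq_sum)
  also have "(\<Sum>i<n. sqrt (t ^ i) * sqrt (t ^ (n - 1 - i))) = (\<Sum>i<n. sqrt (t ^ (n - 1)))"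
    by (intro sum.cong) (auto simp: real_sqrt_mult[symmetric] power_add[symmetric])
  also have "(\<Sum>i<n. (sqrt (t ^ i))\<^sup>2) = (\<Sum>i<n. t ^ i)" using t by simp
  also have "(\<Sum>i<n. (sqrt (t ^ (n - 1 - i)))\<^sup>2) = (\<Sum>i<n. t ^ (n - Suc i))" using t by simp
  also have "\<dots> = (\<Sum>i<n. t ^ i)" by (rule sum.nat_diff_reindex)
  also have "(\<Sum>i<n. t ^ i) * (\<Sum>i<n. t ^ i) = (\<Sum>i<n. t ^ i)\<^sup>2" by (simp only: power2_eq_square)
  finally show ?thesis using t by (simp add: power_mult_distrib)
qed

text \<open>This is what monotonicity of \<open>monsky\<close> reduces to. Multiplying the previous
  bound for \<open>n\<close> and for \<open>Suc n\<close> gives exponent \<open>2 * n - 1\<close>,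
  so the comparison is made between squares.\<close>

lemma geometric_sum_mult_ge:
  fixes t :: real
  assumes t: "0 < t" "t < 1" and n: "n > 0"
  shows "real n * real (Suc n) * t ^ n \<le> (\<Sum>i<n. t ^ i) * (\<Sum>i<Suc n. t ^ i)"
proof (rule power2_le_imp_le)
  have "(real n * real (Suc n) * t ^ n)\<^sup>2 \<le> ((real n)\<^sup>2 * t ^ (n - 1)) * ((real (Suc n))\<^sup>2 * t ^ n)"
  proof -
    have "t ^ n * t ^ n \<le> t ^ (n - 1) * t ^ n"
      using t by (intro mult_right_mono power_decreasing) auto
    from mult_left_mono[OF this, of "(real n * real (Suc n))\<^sup>2"]
    show ?thesis by (simp add: power_mult_distrib power2_eq_square mult_ac)
  qed
  also have "\<dots> \<le> (\<Sum>i<n. t ^ i)\<^sup>2 * (\<Sum>i<Suc n. t ^ i)\<^sup>2"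
    using geometric_sum_square_ge[OF t(1) n] geometric_sum_square_ge[OF t(1), of "Suc n"] t
    by (intro mult_mono) auto
  finally show "(real n * real (Suc n) * t ^ n)\<^sup>2 \<le> ((\<Sum>i<n. t ^ i) * (\<Sum>i<Suc n. t ^ i))\<^sup>2"
    by (simp only: power_mult_distrib)
  show "0 \<le> (\<Sum>i<n. t ^ i) * (\<Sum>i<Suc n. t ^ i)"
    using t by (intro mult_nonneg_nonneg sum_nonneg) auto
qed

text \<open>The difference between \<open>1 / (n (1 - t))\<close>, whose \<open>\<chi>\<close>-twisted sum is a multiple of
  \<open>L(1, \<chi>)\<close>, and the Lambert kernel. It decreases in \<open>n\<close> from 1, so by partial summation its
  \<open>\<chi>\<close>-twisted sums are bounded uniformly in \<open>t\<close>.\<close>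

definition monsky :: "real \<Rightarrow> nat \<Rightarrow> real" where
  "monsky t n = 1 / (real n * (1 - t)) - t ^ n / (1 - t ^ n)"

lemma monsky_1: "t \<noteq> 1 \<Longrightarrow> monsky t 1 = 1"
  by (simp add: monsky_def diff_divide_distrib[symmetric])

text \<open>With \<open>s n\<close> the geometric sum of length \<open>n\<close>,
  \<open>(1 - t) * monsky t n = 1 / n - t ^ n / s n\<close>. The subtracted quotient drops by
  \<open>t ^ n / (s n * s (Suc n))\<close> from \<open>n\<close> to \<open>Suc n\<close>, and
  \<open>1 / n\<close> drops by \<open>1 / (n * Suc n)\<close>, which is at least as much.\<close>

lemma
  assumes t: "0 < t" "t < 1" and n: "n \<ge> 1"
  shows monsky_nonneg: "0 \<le> monsky t n"
    and monsky_antimono: "monsky t (Suc n) \<le> monsky t n"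
proof -
  define s where "s = (\<lambda>n. \<Sum>i<n. t ^ i)"
  have s0: "s n > 0" if "n \<ge> 1" for n
    unfolding s_def using t that by (intro sum_pos) (auto simp: lessThan_empty_iff)
  have "1 - t ^ n = (1 - t) * s n" for n
    unfolding s_def by (rule one_diff_power_eq)
  hence "monsky t n = 1 / (real n * (1 - t)) - t ^ n / ((1 - t) * s n)" for n
    by (simp add: monsky_def)
  hence m: "(1 - t) * monsky t n = 1 / real n - t ^ n / s n" for n
    using t by (simp only: right_diff_distrib[of "1 - t"]) simp
  have "(\<Sum>i<n. t ^ n) \<le> s n"
    unfolding s_def using t by (intro sum_mono power_decreasing) auto
  hence "t ^ n / s n \<le> 1 / real n"
    using n s0[OF n] by (simp add: field_simps)
  hence "0 \<le> (1 - t) * monsky t n" by (simp add: m)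
  thus "0 \<le> monsky t n" using t by (simp add: zero_le_mult_iff)
  have s1: "s (Suc n) = 1 + t * s n"
    unfolding s_def by (simp only: sum.lessThan_Suc_shift) (simp add: sum_distrib_left)
  have sn: "s n > 0" "s (Suc n) > 0" using s0 n by auto
  have g: "real n * real (Suc n) * t ^ n \<le> s n * s (Suc n)"
    unfolding s_def using geometric_sum_mult_ge[OF t, of n] n by simp
  have "t ^ n / s n - t ^ Suc n / s (Suc n) = t ^ n * (s (Suc n) - t * s n) / (s n * s (Suc n))"
    using sn by (simp add: divide_simps) (simp add: algebra_simps)
  also have "\<dots> = t ^ n / (s n * s (Suc n))" by (simp add: s1)
  also have "\<dots> \<le> 1 / (real n * real (Suc n))"
    using g n sn by (simp add: divide_simps mult_ac)
  also have "\<dots> = 1 / real n - 1 / real (Suc n)" using n by (simp add: field_simps)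
  finally have "(1 - t) * monsky t (Suc n) \<le> (1 - t) * monsky t n" unfolding m by linarith
  thus "monsky t (Suc n) \<le> monsky t n" using t by simp
qed

section \<open>The Lambert series of a real character near 1\<close>

context real_dchar
begin

text \<open>The three terms bound the partial sum of \<open>L(1, \<chi>) = 0\<close> divided by
  \<open>1 - t\<close>, the twisted sum of \<open>monsky\<close>, and the truncation of the
  geometric series. Only the middle one survives as \<open>N\<close> tends to infinity, and it is
  free of \<open>t\<close>.\<close>

lemma sum_divisors_r_power_le:
  assumes np: "\<chi> \<noteq> principal_dchar k" and L: "dirichlet_L1 \<chi> = 0" and t: "0 < t" "t < 1"
  shows "(\<Sum>n=1..N. (\<Sum>d | d dvd n. r d) * t ^ n) \<le>
    4 * real k / (real (Suc N) * (1 - t)) + 4 * real k + real N * t ^ N / (1 - t)"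
proof -
  have td: "t ^ d \<le> t" "t ^ d < 1" if "d \<ge> 1" for d
    using t that power_decreasing[of 1 d t] by auto
  have "(\<Sum>n=1..N. (\<Sum>d | d dvd n. r d) * t ^ n) = (\<Sum>n=1..N. \<Sum>d | d dvd n. r d * (t ^ d) ^ (n div d))"
    by (simp add: sum_distrib_right power_mult[symmetric])
  also have "\<dots> = (\<Sum>d=1..N. \<Sum>m=1..N div d. r d * (t ^ d) ^ m)"
    by (rule sum_divisors_hyperbola)
  also have "\<dots> = (\<Sum>d=1..N. r d * (t ^ d / (1 - t ^ d)) - r d * ((t ^ d) ^ Suc (N div d) / (1 - t ^ d)))"
  proof (rule sum.cong[OF refl])
    fix d assume d: "d \<in> {1..N}"
    have "(\<Sum>m=1..N div d. (t ^ d) ^ m) = (t ^ d - (t ^ d) ^ Suc (N div d)) / (1 - t ^ d)"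
      using d td(2)[of d] sum_gp[of "t ^ d" 1 "N div d"] by (auto simp: div_le_dividend Suc_le_eq div_greater_zero_iff)
    thus "(\<Sum>m=1..N div d. r d * (t ^ d) ^ m) = r d * (t ^ d / (1 - t ^ d)) - r d * ((t ^ d) ^ Suc (N div d) / (1 - t ^ d))"
      by (simp only: sum_distrib_left[symmetric] diff_divide_distrib right_diff_distrib)
  qed
  also have "\<dots> = (\<Sum>d=1..N. r d / real d) / (1 - t) - (\<Sum>d=1..N. r d * monsky t d)
      - (\<Sum>d=1..N. r d * ((t ^ d) ^ Suc (N div d) / (1 - t ^ d)))"
    unfolding sum_divide_distrib sum_subtractf[symmetric]
    by (intro sum.cong) (auto simp: monsky_def right_diff_distrib)
  also have "\<dots> \<le> 4 * real k / (real (Suc N) * (1 - t)) + 4 * real k + real N * t ^ N / (1 - t)"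
  proof -
    have "(\<Sum>d=1..N. \<chi> d / of_nat d) = of_real (\<Sum>d=1..N. r d / real d)"
      by (simp add: dchar_eq_r)
    hence "\<bar>\<Sum>d=1..N. r d / real d\<bar> \<le> 4 * real k / real (Suc N)"
      using dirichlet_L1_tail[OF k dchar np, of N]
      by (simp only: L diff_0 norm_minus_cancel norm_of_real)
    hence 1: "(\<Sum>d=1..N. r d / real d) / (1 - t) \<le> 4 * real k / real (Suc N) / (1 - t)"
      using t by (intro divide_right_mono) auto
    have "norm (\<Sum>d=1..N. of_real (monsky t d) * \<chi> d) \<le> 4 * real k * monsky t 1"
      by (intro norm_sum_antimono_le norm_sum_dchar_le k dchar np monsky_nonneg monsky_antimono t) auto
    also have "(\<Sum>d=1..N. of_real (monsky t d) * \<chi> d) = of_real (\<Sum>d=1..N. r d * monsky t d)"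
      by (simp add: dchar_eq_r mult.commute)
    finally have 2: "\<bar>\<Sum>d=1..N. r d * monsky t d\<bar> \<le> 4 * real k"
      using monsky_1[of t] t by (simp only: norm_of_real)
    have "\<bar>\<Sum>d=1..N. r d * ((t ^ d) ^ Suc (N div d) / (1 - t ^ d))\<bar> \<le> (\<Sum>d=1..N. t ^ N / (1 - t))"
    proof (rule order.trans[OF sum_abs sum_mono])
      fix d assume d: "d \<in> {1..N}"
      \<comment> \<open>The first omitted power of \<open>t ^ d\<close> has total exponent at least
        \<open>N\<close>, so each truncation error is at most
        \<open>t ^ N / (1 - t)\<close>.\<close>
      have "N \<le> d * Suc (N div d)" using d by (simp add: dividend_less_times_div less_imp_le)
      hence "t ^ (d * Suc (N div d)) \<le> t ^ N" using t by (intro power_decreasing) auto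
      hence "(t ^ d) ^ Suc (N div d) / (1 - t ^ d) \<le> t ^ N / (1 - t)"
        unfolding power_mult using d td[of d] t by (intro frac_le) auto
      moreover have "0 \<le> (t ^ d) ^ Suc (N div d) / (1 - t ^ d)"
        using d td(2)[of d] t by (intro divide_nonneg_nonneg) auto
      moreover have "\<bar>r d\<bar> \<le> 1" using r_values[of d] by auto
      ultimately have "\<bar>r d\<bar> * \<bar>(t ^ d) ^ Suc (N div d) / (1 - t ^ d)\<bar> \<le> 1 * (t ^ N / (1 - t))"
        by (intro mult_mono) (simp_all only: abs_of_nonneg abs_ge_zero zero_le_one)
      thus "\<bar>r d * ((t ^ d) ^ Suc (N div d) / (1 - t ^ d))\<bar> \<le> t ^ N / (1 - t)"
        by (simp only: abs_mult mult_1)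
    qed
    hence "\<bar>\<Sum>d=1..N. r d * ((t ^ d) ^ Suc (N div d) / (1 - t ^ d))\<bar> \<le> real N * t ^ N / (1 - t)" by simp
    with 1 2 show ?thesis by (simp only: divide_divide_eq_left)
  qed
  finally show ?thesis .
qed

text \<open>Keep only the squares in the Lambert series, where the coefficients are at least 1, and
  let \<open>N\<close> tend to infinity for fixed \<open>t\<close>. The bound is uniform in
  \<open>t\<close> and \<open>M\<close>.\<close>

lemma sum_power_squares_le:
  assumes np: "\<chi> \<noteq> principal_dchar k" and L: "dirichlet_L1 \<chi> = 0" and t: "0 < t" "t < 1"
  shows "(\<Sum>m=1..M. t ^ (m\<^sup>2)) \<le> 4 * real k"
proof (rule tendsto_lowerbound)
  have "(\<lambda>N. inverse (real (Suc N)) * (4 * real k / (1 - t)) + 4 * real k + (real N * t ^ N) / (1 - t))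
     \<longlonglongrightarrow> 0 * (4 * real k / (1 - t)) + 4 * real k + 0 / (1 - t)"
    using t by (intro tendsto_intros LIMSEQ_inverse_real_of_nat powser_times_n_limit_0) auto
  thus "(\<lambda>N. inverse (real (Suc N)) * (4 * real k / (1 - t)) + 4 * real k + (real N * t ^ N) / (1 - t))
     \<longlonglongrightarrow> 4 * real k" by simp
  show "eventually (\<lambda>N. (\<Sum>m=1..M. t ^ (m\<^sup>2)) \<le>
      inverse (real (Suc N)) * (4 * real k / (1 - t)) + 4 * real k + (real N * t ^ N) / (1 - t)) sequentially"
    using eventually_ge_at_top[of "M\<^sup>2"]
  proof eventually_elim
    case (elim N)
    have inj: "inj_on (\<lambda>m. m\<^sup>2) {1..M}" by (auto simp: inj_on_def)
    have sub: "(\<lambda>m. m\<^sup>2) ` {1..M} \<subseteq> {1..N}"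
    proof (clarify)
      fix m assume m: "m \<in> {1..M}"
      hence "m\<^sup>2 \<le> M\<^sup>2" by (intro power_mono) auto
      hence "m\<^sup>2 \<le> N" using elim by (rule order.trans)
      thus "m\<^sup>2 \<in> {1..N}" using m by (auto simp: Suc_le_eq)
    qed
    have "(\<Sum>m=1..M. t ^ (m\<^sup>2)) \<le> (\<Sum>m=1..M. (\<Sum>d | d dvd m\<^sup>2. r d) * t ^ (m\<^sup>2))"
    proof (rule sum_mono)
      fix m assume "m \<in> {1..M}"
      hence "1 * t ^ (m\<^sup>2) \<le> (\<Sum>d | d dvd m\<^sup>2. r d) * t ^ (m\<^sup>2)"
        using t by (intro mult_right_mono sum_divisors_r) auto
      thus "t ^ (m\<^sup>2) \<le> (\<Sum>d | d dvd m\<^sup>2. r d) * t ^ (m\<^sup>2)" by simp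
    qed
    also have "\<dots> = (\<Sum>n\<in>(\<lambda>m. m\<^sup>2) ` {1..M}. (\<Sum>d | d dvd n. r d) * t ^ n)"
      using inj by (simp add: sum.reindex)
    also have "\<dots> \<le> (\<Sum>n=1..N. (\<Sum>d | d dvd n. r d) * t ^ n)"
      using sub t by (intro sum_mono2 mult_nonneg_nonneg sum_divisors_r) auto
    also have "\<dots> \<le> 4 * real k / (real (Suc N) * (1 - t)) + 4 * real k + real N * t ^ N / (1 - t)"
      by (rule sum_divisors_r_power_le[OF np L t])
    also have "4 * real k / (real (Suc N) * (1 - t)) = inverse (real (Suc N)) * (4 * real k / (1 - t))"
      by (simp only: inverse_eq_divide times_divide_times_eq mult_1)
    finally show ?case .
  qed
qed simp

lemma dirichlet_L1_nonzero:
  assumes np: "\<chi> \<noteq> principal_dchar k"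
  shows "dirichlet_L1 \<chi> \<noteq> 0"
proof
  assume L: "dirichlet_L1 \<chi> = 0"
  \<comment> \<open>As \<open>t\<close> tends to 1 from below, the sum over \<open>M\<close> squares
    tends to \<open>M\<close>, one more than the bound \<open>4 * k\<close>.\<close>
  define M where "M = 4 * k + 1"
  have "((\<lambda>t. \<Sum>m=1..M. t ^ (m\<^sup>2)) \<longlongrightarrow> (\<Sum>m=1..M. 1 ^ (m\<^sup>2))) (at_left (1::real))"
    by (intro tendsto_intros)
  moreover have "eventually (\<lambda>t. (\<Sum>m=1..M. t ^ (m\<^sup>2)) \<le> 4 * real k) (at_left (1::real))"
    using eventually_at_left_real[of 0 1] sum_power_squares_le[OF np L]
    by (auto elim: eventually_mono)
  ultimately have "(\<Sum>m=1..M. 1 ^ (m\<^sup>2)) \<le> 4 * real k"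
    by (rule tendsto_upperbound) simp
  thus False by (simp add: M_def)
qed

end

lemma vanishing_dchars_empty:
  assumes k: "k > 0"
  shows "vanishing_dchars k = {}"
proof (rule ccontr)
  assume "vanishing_dchars k \<noteq> {}"
  then obtain \<chi> where \<chi>: "\<chi> \<in> vanishing_dchars k" by blast
  interpret real_dchar k \<chi>
    by unfold_locales (use \<chi> k vanishing_dchars_real[OF k \<chi>] in \<open>auto simp: vanishing_dchars_def\<close>)
  show False using dirichlet_L1_nonzero \<chi> by (auto simp: vanishing_dchars_def)
qed

section \<open>Primes in arithmetic progressions\<close>

lemma sum_powers_ge_2_le:
  fixes x :: real
  assumes "0 \<le> x" "x \<le> 1 / 2"
  shows "(\<Sum>j=2..N. x ^ j) \<le> 2 * x\<^sup>2"
proof (cases "N \<ge> 1")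
  case True
  \<comment> \<open>The induction carries a bound for the remaining tail;
    \<open>2 * x \<le> 1\<close> lets it absorb the next term.\<close>
  hence "(\<Sum>j=2..N. x ^ j) + 2 * x ^ Suc N \<le> 2 * x\<^sup>2"
  proof (induction N rule: dec_induct)
    case (step N)
    have "2 * x * x ^ Suc N \<le> 1 * x ^ Suc N"
      using assms by (intro mult_right_mono) auto
    thus ?case using step by (simp add: mult_ac)
  qed (simp add: power2_eq_square)
  moreover have "0 \<le> x ^ Suc N" using assms by simp
  ultimately show ?thesis by linarith
qed (use assms in auto)

text \<open>A proper prime power is coded as a pair (base, exponent), both at least 2, and the sum
  is enlarged to all such pairs, composite bases included. The sum over exponents is at most
  \<open>2 / p\<^sup>2\<close>, and \<open>ln p\<close> is at most twice the square root of
  \<open>p\<close>, so a convergent series with exponent \<open>-3 / 2\<close> remains.\<close>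

lemma sum_mangoldt_nonprime_bounded:
  "\<exists>C. \<forall>N. (\<Sum>n | n \<in> {1..N} \<and> \<not> prime n. mangoldt n / real n) \<le> C"
proof (intro exI allI)
  fix N :: nat
  define A where "A = {n \<in> {1..N}. primepow n \<and> \<not> prime n}"
  define g where "g = (\<lambda>n::nat. (aprimedivisor n, multiplicity (aprimedivisor n) n))"
  define h :: "nat \<times> nat \<Rightarrow> real" where "h = (\<lambda>(p, j). ln (real p) / real p ^ j)"
  have dec: "(case g n of (p, j) \<Rightarrow> p ^ j) = n" if "n \<in> A" for n
    using that primepow_decompose[of n] by (simp add: A_def g_def)
  have gA: "g n \<in> {2..N} \<times> {2..N}" if n: "n \<in> A" for n
  proof -
    define p j where "p = aprimedivisor n" and "j = multiplicity p n"
    have n': "n \<in> {1..N}" "primepow n" "\<not> prime n" using n by (auto simp: A_def)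
    have p: "prime p" unfolding p_def using n'(2) primepow_gt_Suc_0[OF n'(2)]
      by (intro prime_aprimedivisor') auto
    have pj: "p ^ j = n" using dec[OF n] by (simp add: g_def p_def j_def)
    have "j \<noteq> 0" using pj primepow_gt_Suc_0[OF n'(2)] by (intro notI) simp
    moreover have "j \<noteq> 1" using pj p n'(3) by (intro notI) simp
    ultimately have j: "j \<ge> 2" by simp
    have "p \<le> p ^ j" using j prime_gt_0_nat[OF p] by (intro self_le_power) auto
    moreover have "j < p ^ j" using prime_gt_1_nat[OF p] by (intro power_gt_expt) simp
    ultimately show ?thesis
      using n'(1) pj j prime_ge_2_nat[OF p] by (auto simp: g_def p_def j_def)
  qed
  have "(\<Sum>n | n \<in> {1..N} \<and> \<not> prime n. mangoldt n / real n) = (\<Sum>n\<in>A. mangoldt n / real n)"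
    by (rule sum.mono_neutral_right) (auto simp: A_def mangoldt_def)
  also have "\<dots> = (\<Sum>n\<in>A. h (g n))"
  proof (rule sum.cong[OF refl])
    fix n assume n: "n \<in> A"
    have "real (aprimedivisor n) ^ multiplicity (aprimedivisor n) n = real n"
      using dec[OF n] by (simp add: g_def flip: of_nat_power)
    thus "mangoldt n / real n = h (g n)"
      using n by (simp add: h_def g_def A_def mangoldt_def)
  qed
  also have "\<dots> = sum h (g ` A)"
  proof -
    have "inj_on g A" by (rule inj_onI) (metis dec)
    thus ?thesis by (simp add: sum.reindex)
  qed
  also have "\<dots> \<le> sum h ({2..N} \<times> {2..N})"
  proof (rule sum_mono2)
    show "g ` A \<subseteq> {2..N} \<times> {2..N}" using gA by blast
  qed (auto simp: h_def)
  also have "\<dots> = (\<Sum>p=2..N. ln (real p) * (\<Sum>j=2..N. (1 / real p) ^ j))"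
    by (simp add: h_def sum.cartesian_product sum_distrib_left power_inverse divide_inverse case_prod_unfold)
  also have "\<dots> \<le> (\<Sum>p=2..N. 4 * real p powr (-3 / 2))"
  proof (rule sum_mono)
    fix p assume p: "p \<in> {2..N}"
    have "ln (real p) * (\<Sum>j=2..N. (1 / real p) ^ j) \<le> (2 * real p powr (1 / 2)) * (2 * (1 / real p)\<^sup>2)"
    proof (intro mult_mono sum_powers_ge_2_le)
      have "ln (real p) = 2 * ln (real p powr (1 / 2))" using p by (simp add: ln_powr)
      also have "ln (real p powr (1 / 2)) \<le> real p powr (1 / 2)"
        using ln_le_minus_one[of "real p powr (1 / 2)"] p by simp
      finally show "ln (real p) \<le> 2 * real p powr (1 / 2)" by simp
    qed (use p in \<open>auto simp: field_simps intro!: sum_nonneg\<close>)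
    also have "\<dots> = 4 * (real p powr (1 / 2) * real p powr (-2))"
      using p by (simp add: powr_minus power_one_over field_simps)
    also have "\<dots> = 4 * real p powr (-3 / 2)" by (simp only: powr_add[symmetric]) simp
    finally show "ln (real p) * (\<Sum>j=2..N. (1 / real p) ^ j) \<le> 4 * real p powr (-3 / 2)" .
  qed
  also have "\<dots> \<le> (\<Sum>p. 4 * real p powr (-3 / 2))"
    by (rule sum_le_suminf) (auto intro!: summable_mult simp: summable_real_powr_iff)
  finally show "(\<Sum>n | n \<in> {1..N} \<and> \<not> prime n. mangoldt n / real n) \<le> \<dots>" .
qed

lemma infinite_primes_cong_nat:
  fixes a k :: nat
  assumes k: "k > 0" and a: "coprime a k"
  shows "infinite {p. prime p \<and> [p = a] (mod k)}"
proof
  assume fin: "finite {p. prime p \<and> [p = a] (mod k)}"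
  \<comment> \<open>With this inverse, \<open>b * n \<equiv> 1\<close> holds exactly for
    \<open>n \<equiv> a\<close>.\<close>
  obtain b where b: "[a * b = 1] (mod k)" using cong_solve_coprime_nat[OF a] by auto
  have "coprime (a * b) k" using cong_imp_coprime[OF cong_sym[OF b]] by simp
  hence cb: "coprime b k" by simp
  define S where "S = (\<lambda>N. \<Sum>n | n \<in> {1..N} \<and> [b * n = 1] (mod k). mangoldt n / real n)"
  define P where "P = {p. prime p \<and> [p = a] (mod k)}"
  obtain C where C: "\<And>N. (\<Sum>n | n \<in> {1..N} \<and> \<not> prime n. mangoldt n / real n) \<le> C"
    using sum_mangoldt_nonprime_bounded by blast
  have S: "S N \<le> (\<Sum>p\<in>P. mangoldt p / real p) + C" for N
  proof -
    have "S N \<le> (\<Sum>n\<in>P \<union> {n. n \<in> {1..N} \<and> \<not> prime n}. mangoldt n / real n)"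
      unfolding S_def
    proof (rule sum_mono2)
      show "finite (P \<union> {n \<in> {1..N}. \<not> prime n})" using fin by (simp add: P_def)
      show "{n \<in> {1..N}. [b * n = 1] (mod k)} \<subseteq> P \<union> {n \<in> {1..N}. \<not> prime n}"
      proof (clarify, unfold P_def, safe)
        fix n assume "[b * n = 1] (mod k)"
        hence "[b * n = b * a] (mod k)" using b cong_sym cong_trans by (metis mult.commute)
        thus "[n = a] (mod k)" using cb by (simp add: cong_mult_lcancel_nat)
      qed
    qed (auto intro!: divide_nonneg_nonneg mangoldt_nonneg)
    also have "\<dots> = (\<Sum>p\<in>P. mangoldt p / real p) + (\<Sum>n | n \<in> {1..N} \<and> \<not> prime n. mangoldt n / real n)"
      using fin by (intro sum.union_disjoint) (auto simp: P_def)
    finally show ?thesis using C[of N] by simp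
  qed
  obtain D where D: "\<And>N. N \<ge> 1 \<Longrightarrow> norm (of_nat (card (dchars k)) * of_real (S N) -
      (1 - 0) * complex_of_real (ln (real N))) \<le> D"
    using mangoldt_progression_asymptotics[OF k cb]
    unfolding vanishing_dchars_empty[OF k] sum.empty S_def by blast
  define E where "E = real (card (dchars k)) * ((\<Sum>p\<in>P. mangoldt p / real p) + C) + D"
  obtain N where N: "N \<ge> 1" "E < ln (real N)" using ln_nat_unbounded by blast
  have "of_nat (card (dchars k)) * of_real (S N) - (1 - 0) * complex_of_real (ln (real N)) =
      of_real (real (card (dchars k)) * S N - ln (real N))" by simp
  hence "\<bar>real (card (dchars k)) * S N - ln (real N)\<bar> \<le> D"
    using D[OF N(1)] by (simp only: norm_of_real)
  moreover have "real (card (dchars k)) * S N \<le> real (card (dchars k)) * ((\<Sum>p\<in>P. mangoldt p / real p) + C)"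
    by (intro mult_left_mono S) auto
  ultimately show False using N(2) unfolding E_def by linarith
qed

theorem mainTheorem1:
  fixes a k :: int
  assumes "k \<ge> 1" and "gcd a k = 1"
  shows "infinite {q :: int. prime q \<and> (\<exists>\<mu> :: nat. q = a + int \<mu> * k)}"
proof
  assume fin: "finite {q :: int. prime q \<and> (\<exists>\<mu> :: nat. q = a + int \<mu> * k)}"
  define a' where "a' = nat (a mod k)"
  have a': "int a' = a mod k" using assms(1) by (simp add: a'_def)
  have k': "int (nat k) = k" "nat k > 0" using assms(1) by auto
  have "gcd (int a') (int (nat k)) = 1" using assms by (simp add: a' k' gcd_mod_left)
  hence "coprime a' (nat k)" by (simp only: coprime_iff_gcd_eq_1[symmetric] coprime_int_iff)
  hence "infinite {p. prime p \<and> [p = a'] (mod nat k)}"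
    by (rule infinite_primes_cong_nat[OF k'(2)])
  \<comment> \<open>Primes up to \<open>\<bar>a\<bar>\<close> are set aside: beyond them
    \<open>p > a\<close>, so the multiple of \<open>k\<close> in \<open>p - a\<close> is positive
    and \<open>\<mu>\<close> can be a natural number.\<close>
  moreover have "{p. prime p \<and> [p = a'] (mod nat k)} \<subseteq>
      {..nat \<bar>a\<bar>} \<union> nat ` {q :: int. prime q \<and> (\<exists>\<mu> :: nat. q = a + int \<mu> * k)}"
  proof
    fix p assume "p \<in> {p. prime p \<and> [p = a'] (mod nat k)}"
    hence p: "prime p" "[p = a'] (mod nat k)" by auto
    show "p \<in> {..nat \<bar>a\<bar>} \<union> nat ` {q :: int. prime q \<and> (\<exists>\<mu> :: nat. q = a + int \<mu> * k)}"
    proof (cases "int p \<le> \<bar>a\<bar>")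
      case False
      have "[int p = int a'] (mod int (nat k))" using p(2) by (simp only: cong_int_iff)
      hence "[int p = a] (mod k)" unfolding a' k'(1) by (simp add: cong_def)
      then obtain m where m: "int p - a = k * m" by (auto simp: cong_iff_dvd_diff elim: dvdE)
      have "0 < k * m" using False m by linarith
      hence "0 \<le> m" using assms(1) by (simp add: zero_less_mult_iff)
      hence "int p = a + int (nat m) * k" using m by (simp add: mult.commute)
      moreover have "prime (int p)" using p(1) by simp
      ultimately have "int p \<in> {q :: int. prime q \<and> (\<exists>\<mu> :: nat. q = a + int \<mu> * k)}"
        by blast
      from imageI[OF this, of nat] show ?thesis by (intro UnI2) (simp only: nat_int)
    qed auto
  qed
  ultimately show False using fin by (meson finite_UnI finite_atMost finite_imageI finite_subset)
qed

end
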